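(* Let $\mathcal{C}$ be a premodel category. There is a class of equivalences which, together with the cofibrations and fibrations of $\mathcal{C}$, makes $\mathcal{C}$ into a Fresse left semi-model category if and only if the following conditions hold: (1) $\mathcal{C}$ is a weak model category. (2) Every cofibrant object $X$ of $\mathcal{C}$ admits a strong cylinder object, i.e. a factorization of the codiagonal map $X \coprod X \to IX \to X$ in which $X\coprod X \to IX$ is a cofibration and the composite $X \to IX$ of this cofibration with the first coproduct inclusion $X \to X \coprod X$ is an acyclic cofibration. (3) $\mathcal{C}$ is core left saturated. When these conditions hold, the class of equivalences is unique. Moreover, $\mathcal{C}$ is then a Spitzweck left semi-model category if and only if it is also right saturated.
   Context: Premodel category: a complete and cocomplete category with two weak factorization systems, (cofibrations, anodyne fibrations) and (anodyne cofibrations, fibrations), such that every anodyne cofibration is a cofibration (equivalently every anodyne fibration is a fibration). An object is cofibrant if the map from the initial object is a cofibration, fibrant if the map to the terminal object is a fibration. An acyclic cofibration is a cofibration with the left lifting property against all fibrations between fibrant objects; an acyclic fibration is a fibration with the right lifting property against all cofibrations between cofibrant objects. A core cofibration is a cofibration with cofibrant domain; a core fibration is a fibration with fibrant target. Weak model category: a premodel category such that (i) every cofibration $A \to X$ from a cofibrant object to a fibrant object has a relative strong cylinder object, i.e. a factorization $X \coprod_A X \to I_A X \to X$ of the codiagonal whose first map is a cofibration and such that the composite $X \to I_A X$ with the first inclusion is an acyclic cofibration; (ii) every fibration $A \to X$ from a cofibrant object to a fibrant object has a relative strong path object, i.e. a factorization $A \to P_X A \to A \times_X A$ of the diagonal whose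 second map is a fibration and such that the composite $P_X A \to A$ with the first projection is an acyclic fibration. Saturation: a premodel category is right saturated if all acyclic fibrations are anodyne fibrations; core left saturated if all core acyclic cofibrations (acyclic cofibrations with cofibrant domain) are anodyne cofibrations. Fresse left semi-model category: a category with limits and colimits and three classes of maps (weak) equivalences, cofibrations, fibrations such that: (1) weak equivalences satisfy 2-out-of-3 and all three classes are stable under retracts; (2) any map with cofibrant domain can be factored as a cofibration followed by a trivial fibration, and as a trivial cofibration followed by a fibration (trivial (co)fibration = (co)fibration that is an equivalence); (3) given a core cofibration $i$ and a fibration $p$, one of them being an equivalence, $i$ has the left lifting property against $p$; (4) fibrations are stable under pullback; (5) the initial object is cofibrant. A Spitzweck left semi-model category is a Fresse left semi-model category in which cofibrations and trivial fibrations form a weak factorization system (with no restriction on domains). *)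

theory Defs
  imports "HOL-Library.Equipollence"
begin

text \<open>Composition is written in the order of functions: \<open>g \<cdot> f\<close> is \<open>g\<close> after \<open>f\<close>.
  Outside of composable pairs of arrows its value is unspecified.\<close>

record ('o, 'a) category =
  Obj :: "'o set"
  Arr :: "'a set"
  Dom :: "'a \<Rightarrow> 'o"
  Cod :: "'a \<Rightarrow> 'o"
  Ide :: "'o \<Rightarrow> 'a"
  Comp :: "'a \<Rightarrow> 'a \<Rightarrow> 'a"  (infixr "\<cdot>\<index>" 70)

definition hom :: "('o, 'a, 'm) category_scheme \<Rightarrow> 'o \<Rightarrow> 'o \<Rightarrow> 'a set" where
  "hom C X Y = {f \<in> Arr C. Dom C f = X \<and> Cod C f = Y}"

locale category =
  fixes C :: "('o, 'a, 'm) category_scheme" (structure)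
  assumes Dom_Obj: "f \<in> Arr C \<Longrightarrow> Dom C f \<in> Obj C"
    and Cod_Obj: "f \<in> Arr C \<Longrightarrow> Cod C f \<in> Obj C"
    and Ide_hom: "X \<in> Obj C \<Longrightarrow> Ide C X \<in> hom C X X"
    and Comp_hom: "f \<in> hom C X Y \<Longrightarrow> g \<in> hom C Y Z \<Longrightarrow> g \<cdot> f \<in> hom C X Z"
    and Comp_Ide: "f \<in> hom C X Y \<Longrightarrow> f \<cdot> Ide C X = f"
    and Ide_Comp: "f \<in> hom C X Y \<Longrightarrow> Ide C Y \<cdot> f = f"
    and Comp_assoc: "f \<in> hom C X Y \<Longrightarrow> g \<in> hom C Y Z \<Longrightarrow> h \<in> hom C Z V
      \<Longrightarrow> (h \<cdot> g) \<cdot> f = h \<cdot> (g \<cdot> f)"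


section \<open>Limits and colimits\<close>

definition is_functor ::
  "('i, 'j, 'n) category_scheme \<Rightarrow> ('o, 'a, 'm) category_scheme
    \<Rightarrow> ('i \<Rightarrow> 'o) \<Rightarrow> ('j \<Rightarrow> 'a) \<Rightarrow> bool" where
  "is_functor J C Fo Fa \<longleftrightarrow>
     (\<forall>i \<in> Obj J. Fo i \<in> Obj C) \<and>
     (\<forall>u \<in> Arr J. Fa u \<in> hom C (Fo (Dom J u)) (Fo (Cod J u))) \<and>
     (\<forall>i \<in> Obj J. Fa (Ide J i) = Ide C (Fo i)) \<and>
     (\<forall>u \<in> Arr J. \<forall>v \<in> Arr J. Cod J u = Dom J v \<longrightarrow> Fa (v \<cdot>\<^bsub>J\<^esub> u) = Fa v \<cdot>\<^bsub>C\<^esub> Fa u)"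

definition is_cone ::
  "('i, 'j, 'n) category_scheme \<Rightarrow> ('o, 'a, 'm) category_scheme
    \<Rightarrow> ('i \<Rightarrow> 'o) \<Rightarrow> ('j \<Rightarrow> 'a) \<Rightarrow> 'o \<Rightarrow> ('i \<Rightarrow> 'a) \<Rightarrow> bool" where
  "is_cone J C Fo Fa X l \<longleftrightarrow>
     X \<in> Obj C \<and>
     (\<forall>i \<in> Obj J. l i \<in> hom C X (Fo i)) \<and>
     (\<forall>u \<in> Arr J. Fa u \<cdot>\<^bsub>C\<^esub> l (Dom J u) = l (Cod J u))"

definition is_cocone ::
  "('i, 'j, 'n) category_scheme \<Rightarrow> ('o, 'a, 'm) category_scheme
    \<Rightarrow> ('i \<Rightarrow> 'o) \<Rightarrow> ('j \<Rightarrow> 'a) \<Rightarrow> 'o \<Rightarrow> ('i \<Rightarrow> 'a) \<Rightarrow> bool" where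
  "is_cocone J C Fo Fa X l \<longleftrightarrow>
     X \<in> Obj C \<and>
     (\<forall>i \<in> Obj J. l i \<in> hom C (Fo i) X) \<and>
     (\<forall>u \<in> Arr J. l (Cod J u) \<cdot>\<^bsub>C\<^esub> Fa u = l (Dom J u))"

definition is_limit ::
  "('i, 'j, 'n) category_scheme \<Rightarrow> ('o, 'a, 'm) category_scheme
    \<Rightarrow> ('i \<Rightarrow> 'o) \<Rightarrow> ('j \<Rightarrow> 'a) \<Rightarrow> 'o \<Rightarrow> ('i \<Rightarrow> 'a) \<Rightarrow> bool" where
  "is_limit J C Fo Fa L l \<longleftrightarrow>
     is_cone J C Fo Fa L l \<and>
     (\<forall>X k. is_cone J C Fo Fa X k \<longrightarrow>
        (\<exists>!h. h \<in> hom C X L \<and> (\<forall>i \<in> Obj J. l i \<cdot>\<^bsub>C\<^esub> h = k i)))"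

definition is_colimit ::
  "('i, 'j, 'n) category_scheme \<Rightarrow> ('o, 'a, 'm) category_scheme
    \<Rightarrow> ('i \<Rightarrow> 'o) \<Rightarrow> ('j \<Rightarrow> 'a) \<Rightarrow> 'o \<Rightarrow> ('i \<Rightarrow> 'a) \<Rightarrow> bool" where
  "is_colimit J C Fo Fa L l \<longleftrightarrow>
     is_cocone J C Fo Fa L l \<and>
     (\<forall>X k. is_cocone J C Fo Fa X k \<longrightarrow>
        (\<exists>!h. h \<in> hom C L X \<and> (\<forall>i \<in> Obj J. h \<cdot>\<^bsub>C\<^esub> l i = k i)))"

text \<open>A type \<open>'k\<close>, of which only the cardinality \<open>\<kappa>\<close> matters, plays the role of the universe:
  a category is small if it has fewer than \<open>\<kappa>\<close> arrows, and up to isomorphism such a category has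
  its objects and arrows in \<open>'k\<close>. For \<open>\<kappa>\<close> the cardinality of a Grothendieck universe this is the
  usual notion of smallness. (No single type can index diagrams over all sets: a category
  with products indexed by its own arrows is a preorder.) As soon as \<open>'k\<close> is infinite, all finite
  limits and colimits are among those considered below.\<close>

definition small :: "('k, 'k) category \<Rightarrow> bool" where
  "small J \<longleftrightarrow> Arr J \<prec> (UNIV :: 'k set)"

definition complete :: "'k itself \<Rightarrow> ('o, 'a, 'm) category_scheme \<Rightarrow> bool" where
  "complete K C \<longleftrightarrow>
     (\<forall>(J :: ('k, 'k) category) Fo Fa. category J \<and> small J \<and> is_functor J C Fo Fa \<longrightarrow>
        (\<exists>L l. is_limit J C Fo Fa L l))"

definition cocomplete :: "'k itself \<Rightarrow> ('o, 'a, 'm) category_scheme \<Rightarrow> bool" where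
  "cocomplete K C \<longleftrightarrow>
     (\<forall>(J :: ('k, 'k) category) Fo Fa. category J \<and> small J \<and> is_functor J C Fo Fa \<longrightarrow>
        (\<exists>L l. is_colimit J C Fo Fa L l))"

definition is_initial :: "('o, 'a, 'm) category_scheme \<Rightarrow> 'o \<Rightarrow> bool" where
  "is_initial C Z \<longleftrightarrow> Z \<in> Obj C \<and> (\<forall>X \<in> Obj C. \<exists>!f. f \<in> hom C Z X)"

definition is_terminal :: "('o, 'a, 'm) category_scheme \<Rightarrow> 'o \<Rightarrow> bool" where
  "is_terminal C T \<longleftrightarrow> T \<in> Obj C \<and> (\<forall>X \<in> Obj C. \<exists>!f. f \<in> hom C X T)"

definition is_coproduct :: "('o, 'a, 'm) category_scheme \<Rightarrow> 'o \<Rightarrow> 'o \<Rightarrow> 'a \<Rightarrow> 'a \<Rightarrow> bool" where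
  "is_coproduct C X Y i j \<longleftrightarrow>
     (\<exists>P. i \<in> hom C X P \<and> j \<in> hom C Y P \<and>
        (\<forall>Q. \<forall>u \<in> hom C X Q. \<forall>v \<in> hom C Y Q.
           \<exists>!h. h \<in> hom C P Q \<and> h \<cdot>\<^bsub>C\<^esub> i = u \<and> h \<cdot>\<^bsub>C\<^esub> j = v))"

text \<open>\<open>is_pullback C f g p q\<close>: \<open>p\<close> and \<open>q\<close> are the projections to the domains of \<open>f\<close> and \<open>g\<close>,
  respectively. \<open>is_pushout C f g i j\<close>: \<open>i\<close> and \<open>j\<close> are the inclusions of the codomains of \<open>f\<close>
  and \<open>g\<close>, respectively.\<close>

definition is_pullback :: "('o, 'a, 'm) category_scheme \<Rightarrow> 'a \<Rightarrow> 'a \<Rightarrow> 'a \<Rightarrow> 'a \<Rightarrow> bool" where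
  "is_pullback C f g p q \<longleftrightarrow>
     (\<exists>X Y Z P. f \<in> hom C X Z \<and> g \<in> hom C Y Z \<and> p \<in> hom C P X \<and> q \<in> hom C P Y \<and>
        f \<cdot>\<^bsub>C\<^esub> p = g \<cdot>\<^bsub>C\<^esub> q \<and>
        (\<forall>Q. \<forall>u \<in> hom C Q X. \<forall>v \<in> hom C Q Y. f \<cdot>\<^bsub>C\<^esub> u = g \<cdot>\<^bsub>C\<^esub> v \<longrightarrow>
           (\<exists>!h. h \<in> hom C Q P \<and> p \<cdot>\<^bsub>C\<^esub> h = u \<and> q \<cdot>\<^bsub>C\<^esub> h = v)))"

definition is_pushout :: "('o, 'a, 'm) category_scheme \<Rightarrow> 'a \<Rightarrow> 'a \<Rightarrow> 'a \<Rightarrow> 'a \<Rightarrow> bool" where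
  "is_pushout C f g i j \<longleftrightarrow>
     (\<exists>X Y Z P. f \<in> hom C Z X \<and> g \<in> hom C Z Y \<and> i \<in> hom C X P \<and> j \<in> hom C Y P \<and>
        i \<cdot>\<^bsub>C\<^esub> f = j \<cdot>\<^bsub>C\<^esub> g \<and>
        (\<forall>Q. \<forall>u \<in> hom C X Q. \<forall>v \<in> hom C Y Q. u \<cdot>\<^bsub>C\<^esub> f = v \<cdot>\<^bsub>C\<^esub> g \<longrightarrow>
           (\<exists>!h. h \<in> hom C P Q \<and> h \<cdot>\<^bsub>C\<^esub> i = u \<and> h \<cdot>\<^bsub>C\<^esub> j = v)))"


section \<open>Lifting properties and weak factorization systems\<close>

definition lifts :: "('o, 'a, 'm) category_scheme \<Rightarrow> 'a \<Rightarrow> 'a \<Rightarrow> bool" where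
  "lifts C i p \<longleftrightarrow>
     (\<forall>u \<in> hom C (Dom C i) (Dom C p). \<forall>v \<in> hom C (Cod C i) (Cod C p).
        p \<cdot>\<^bsub>C\<^esub> u = v \<cdot>\<^bsub>C\<^esub> i \<longrightarrow>
        (\<exists>h \<in> hom C (Cod C i) (Dom C p). h \<cdot>\<^bsub>C\<^esub> i = u \<and> p \<cdot>\<^bsub>C\<^esub> h = v))"

definition factors_as :: "('o, 'a, 'm) category_scheme \<Rightarrow> 'a set \<Rightarrow> 'a set \<Rightarrow> 'a \<Rightarrow> bool" where
  "factors_as C L R f \<longleftrightarrow>
     (\<exists>l r. l \<in> L \<and> r \<in> R \<and> l \<in> Arr C \<and> r \<in> Arr C \<and> Cod C l = Dom C r \<and> f = r \<cdot>\<^bsub>C\<^esub> l)"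

definition wfs :: "('o, 'a, 'm) category_scheme \<Rightarrow> 'a set \<Rightarrow> 'a set \<Rightarrow> bool" where
  "wfs C L R \<longleftrightarrow>
     L = {i \<in> Arr C. \<forall>p \<in> R. lifts C i p} \<and>
     R = {p \<in> Arr C. \<forall>i \<in> L. lifts C i p} \<and>
     (\<forall>f \<in> Arr C. factors_as C L R f)"

definition retract_of :: "('o, 'a, 'm) category_scheme \<Rightarrow> 'a \<Rightarrow> 'a \<Rightarrow> bool" where
  "retract_of C f g \<longleftrightarrow>
     f \<in> Arr C \<and> g \<in> Arr C \<and>
     (\<exists>s r s' r'.
        s \<in> hom C (Dom C f) (Dom C g) \<and> r \<in> hom C (Dom C g) (Dom C f) \<and>
        s' \<in> hom C (Cod C f) (Cod C g) \<and> r' \<in> hom C (Cod C g) (Cod C f) \<and>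
        r \<cdot>\<^bsub>C\<^esub> s = Ide C (Dom C f) \<and> r' \<cdot>\<^bsub>C\<^esub> s' = Ide C (Cod C f) \<and>
        g \<cdot>\<^bsub>C\<^esub> s = s' \<cdot>\<^bsub>C\<^esub> f \<and> f \<cdot>\<^bsub>C\<^esub> r = r' \<cdot>\<^bsub>C\<^esub> g)"

definition retract_stable :: "('o, 'a, 'm) category_scheme \<Rightarrow> 'a set \<Rightarrow> bool" where
  "retract_stable C S \<longleftrightarrow> (\<forall>g \<in> S. \<forall>f. retract_of C f g \<longrightarrow> f \<in> S)"

definition pullback_stable :: "('o, 'a, 'm) category_scheme \<Rightarrow> 'a set \<Rightarrow> bool" where
  "pullback_stable C S \<longleftrightarrow> (\<forall>p \<in> S. \<forall>f q p'. is_pullback C p f q p' \<longrightarrow> p' \<in> S)"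

definition two_out_of_three :: "('o, 'a, 'm) category_scheme \<Rightarrow> 'a set \<Rightarrow> bool" where
  "two_out_of_three C W \<longleftrightarrow>
     (\<forall>f \<in> Arr C. \<forall>g \<in> Arr C. Cod C f = Dom C g \<longrightarrow>
        (f \<in> W \<and> g \<in> W \<longrightarrow> g \<cdot>\<^bsub>C\<^esub> f \<in> W) \<and>
        (f \<in> W \<and> g \<cdot>\<^bsub>C\<^esub> f \<in> W \<longrightarrow> g \<in> W) \<and>
        (g \<in> W \<and> g \<cdot>\<^bsub>C\<^esub> f \<in> W \<longrightarrow> f \<in> W))"

definition cofibrant :: "('o, 'a, 'm) category_scheme \<Rightarrow> 'a set \<Rightarrow> 'o \<Rightarrow> bool" where
  "cofibrant C cofs X \<longleftrightarrow> (\<exists>Z f. is_initial C Z \<and> f \<in> hom C Z X \<and> f \<in> cofs)"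

definition fibrant :: "('o, 'a, 'm) category_scheme \<Rightarrow> 'a set \<Rightarrow> 'o \<Rightarrow> bool" where
  "fibrant C fibs X \<longleftrightarrow> (\<exists>T f. is_terminal C T \<and> f \<in> hom C X T \<and> f \<in> fibs)"


section \<open>Premodel categories\<close>

record ('o, 'a) premodel = "('o, 'a) category" +
  Cof :: "'a set"
  AnFib :: "'a set"
  AnCof :: "'a set"
  Fib :: "'a set"

definition premodel_category :: "'k itself \<Rightarrow> ('o, 'a, 'm) premodel_scheme \<Rightarrow> bool" where
  "premodel_category K M \<longleftrightarrow>
     category M \<and> complete K M \<and> cocomplete K M \<and>
     wfs M (Cof M) (AnFib M) \<and> wfs M (AnCof M) (Fib M) \<and> AnCof M \<subseteq> Cof M"

definition acyclic_cofibration :: "('o, 'a, 'm) premodel_scheme \<Rightarrow> 'a \<Rightarrow> bool" where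
  "acyclic_cofibration M i \<longleftrightarrow>
     i \<in> Cof M \<and>
     (\<forall>p \<in> Fib M. fibrant M (Fib M) (Dom M p) \<and> fibrant M (Fib M) (Cod M p) \<longrightarrow> lifts M i p)"

definition acyclic_fibration :: "('o, 'a, 'm) premodel_scheme \<Rightarrow> 'a \<Rightarrow> bool" where
  "acyclic_fibration M p \<longleftrightarrow>
     p \<in> Fib M \<and>
     (\<forall>i \<in> Cof M. cofibrant M (Cof M) (Dom M i) \<and> cofibrant M (Cof M) (Cod M i) \<longrightarrow> lifts M i p)"

text \<open>In the next three definitions, \<open>r \<cdot> j\<close> (resp. \<open>q \<cdot> s\<close>) is the (co)diagonal because it is
  determined by its composites with the two inclusions (resp. projections).\<close>

definition has_relative_strong_cylinder :: "('o, 'a, 'm) premodel_scheme \<Rightarrow> 'a \<Rightarrow> bool" where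
  "has_relative_strong_cylinder M f \<longleftrightarrow>
     (\<exists>i\<^sub>0 i\<^sub>1 I j r.
        is_pushout M f f i\<^sub>0 i\<^sub>1 \<and>
        j \<in> hom M (Cod M i\<^sub>0) I \<and> r \<in> hom M I (Cod M f) \<and>
        (r \<cdot>\<^bsub>M\<^esub> j) \<cdot>\<^bsub>M\<^esub> i\<^sub>0 = Ide M (Cod M f) \<and> (r \<cdot>\<^bsub>M\<^esub> j) \<cdot>\<^bsub>M\<^esub> i\<^sub>1 = Ide M (Cod M f) \<and>
        j \<in> Cof M \<and> acyclic_cofibration M (j \<cdot>\<^bsub>M\<^esub> i\<^sub>0))"

definition has_relative_strong_path :: "('o, 'a, 'm) premodel_scheme \<Rightarrow> 'a \<Rightarrow> bool" where
  "has_relative_strong_path M f \<longleftrightarrow>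
     (\<exists>p\<^sub>0 p\<^sub>1 P s q.
        is_pullback M f f p\<^sub>0 p\<^sub>1 \<and>
        s \<in> hom M (Dom M f) P \<and> q \<in> hom M P (Dom M p\<^sub>0) \<and>
        p\<^sub>0 \<cdot>\<^bsub>M\<^esub> (q \<cdot>\<^bsub>M\<^esub> s) = Ide M (Dom M f) \<and> p\<^sub>1 \<cdot>\<^bsub>M\<^esub> (q \<cdot>\<^bsub>M\<^esub> s) = Ide M (Dom M f) \<and>
        q \<in> Fib M \<and> acyclic_fibration M (p\<^sub>0 \<cdot>\<^bsub>M\<^esub> q))"

definition has_strong_cylinder :: "('o, 'a, 'm) premodel_scheme \<Rightarrow> 'o \<Rightarrow> bool" where
  "has_strong_cylinder M X \<longleftrightarrow>
     (\<exists>i\<^sub>0 i\<^sub>1 I j r.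
        is_coproduct M X X i\<^sub>0 i\<^sub>1 \<and>
        j \<in> hom M (Cod M i\<^sub>0) I \<and> r \<in> hom M I X \<and>
        (r \<cdot>\<^bsub>M\<^esub> j) \<cdot>\<^bsub>M\<^esub> i\<^sub>0 = Ide M X \<and> (r \<cdot>\<^bsub>M\<^esub> j) \<cdot>\<^bsub>M\<^esub> i\<^sub>1 = Ide M X \<and>
        j \<in> Cof M \<and> acyclic_cofibration M (j \<cdot>\<^bsub>M\<^esub> i\<^sub>0))"

definition weak_model_category :: "'k itself \<Rightarrow> ('o, 'a, 'm) premodel_scheme \<Rightarrow> bool" where
  "weak_model_category K M \<longleftrightarrow>
     premodel_category K M \<and>
     (\<forall>i \<in> Cof M. cofibrant M (Cof M) (Dom M i) \<and> fibrant M (Fib M) (Cod M i) \<longrightarrow>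
        has_relative_strong_cylinder M i) \<and>
     (\<forall>p \<in> Fib M. cofibrant M (Cof M) (Dom M p) \<and> fibrant M (Fib M) (Cod M p) \<longrightarrow>
        has_relative_strong_path M p)"

definition right_saturated :: "('o, 'a, 'm) premodel_scheme \<Rightarrow> bool" where
  "right_saturated M \<longleftrightarrow> (\<forall>p. acyclic_fibration M p \<longrightarrow> p \<in> AnFib M)"

definition core_left_saturated :: "('o, 'a, 'm) premodel_scheme \<Rightarrow> bool" where
  "core_left_saturated M \<longleftrightarrow>
     (\<forall>i. acyclic_cofibration M i \<and> cofibrant M (Cof M) (Dom M i) \<longrightarrow> i \<in> AnCof M)"


section \<open>Left semi-model categories\<close>

definition fresse_left_semi_model ::
  "'k itself \<Rightarrow> ('o, 'a, 'm) category_scheme \<Rightarrow> 'a set \<Rightarrow> 'a set \<Rightarrow> 'a set \<Rightarrow> bool" where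
  "fresse_left_semi_model K C W cofs fibs \<longleftrightarrow>
     category C \<and> complete K C \<and> cocomplete K C \<and>
     W \<subseteq> Arr C \<and> cofs \<subseteq> Arr C \<and> fibs \<subseteq> Arr C \<and>
     two_out_of_three C W \<and>
     retract_stable C W \<and> retract_stable C cofs \<and> retract_stable C fibs \<and>
     (\<forall>f \<in> Arr C. cofibrant C cofs (Dom C f) \<longrightarrow>
        factors_as C cofs (fibs \<inter> W) f \<and> factors_as C (cofs \<inter> W) fibs f) \<and>
     (\<forall>i \<in> cofs. \<forall>p \<in> fibs. cofibrant C cofs (Dom C i) \<and> (i \<in> W \<or> p \<in> W) \<longrightarrow> lifts C i p) \<and>
     pullback_stable C fibs \<and>
     (\<forall>Z. is_initial C Z \<longrightarrow> cofibrant C cofs Z)"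

definition spitzweck_left_semi_model ::
  "'k itself \<Rightarrow> ('o, 'a, 'm) category_scheme \<Rightarrow> 'a set \<Rightarrow> 'a set \<Rightarrow> 'a set \<Rightarrow> bool" where
  "spitzweck_left_semi_model K C W cofs fibs \<longleftrightarrow>
     fresse_left_semi_model K C W cofs fibs \<and> wfs C cofs (fibs \<inter> W)"

end

theory Submission
  imports Defs
begin

text \<open>Suppose first that \<open>W\<close> makes the premodel category a semi-model category. The retract argument
  identifies the core cofibrations in \<open>W\<close> with the core anodyne cofibrations, and, after a
  cofibrant replacement of the domain, the fibrations in \<open>W\<close> with the acyclic fibrations. Hence \<open>W\<close>
  contains the anodyne fibrations, and 2-out-of-3 determines \<open>W\<close>: a map \<open>f\<close> is in \<open>W\<close> iff for some
  cofibrant replacement \<open>a\<close> of its domain the composite \<open>f \<cdot> a\<close> factors as an anodyne cofibration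
  followed by an anodyne fibration (\<open>W_iff\<close>). Factoring (co)diagonals now gives cylinders and path
  objects, a comparison with a fibrant replacement gives core left saturation, and being
  Spitzweck means that \<open>Fib \<inter> W\<close>, the class of acyclic fibrations, is the class \<open>AnFib\<close>.

  Conversely, assume the three conditions. For cofibrant \<open>A\<close> and bifibrant \<open>X\<close>, strong cylinders
  of \<open>A\<close> (whose first inclusion is anodyne by core left saturation) and strong path objects of \<open>X\<close>
  make homotopy an equivalence relation on the maps from \<open>A\<close> to \<open>X\<close> (\<open>homotopic_euclidean\<close>). Call
  a map between cofibrant objects an equivalence if it induces bijections on homotopy classes of
  maps into bifibrant objects, and an arbitrary map an equivalence if some lift of it to cofibrant
  replacements is one. Two lifts of a map from a cofibrant object along an anodyne fibration are
  left homotopic, because every cofibrant object has a strong cylinder (\<open>lifts_identified\<close>). So the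
  choice of replacements does not matter, and 2-out-of-3 and stability under retracts are inherited
  from bijections.

  The main point is a Whitehead theorem: a core cofibration \<open>i : A \<rightarrow> B\<close> that is an equivalence is
  anodyne (\<open>core_Cof_equivalence_AnCof\<close>). One may assume that \<open>B\<close> is fibrant. By homotopy extension,
  \<open>i\<close> is a retract of a cofibration \<open>c\<close> from \<open>A\<close> to a fibrant object whose composite \<open>t \<cdot> c\<close> with
  some anodyne fibration \<open>t\<close> is an anodyne cofibration. A relative cylinder of \<open>c\<close> provides a homotopy
  relative to \<open>A\<close> from a section of \<open>t\<close> composed with \<open>t\<close> to the identity, and sliding along it
  solves lifting problems for \<open>c\<close> (\<open>anodyne_of_anodyne_fibration_comp\<close>). The remaining lifting
  property, of core cofibrations against fibrations that are equivalences, reduces by the retract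
  argument to the fact that such a fibration becomes anodyne after cofibrant replacement of its
  domain.\<close>


section \<open>Composition, lifting and retracts\<close>

context category
begin

lemma homD:
  assumes "f \<in> hom C X Y"
  shows "f \<in> Arr C" "Dom C f = X" "Cod C f = Y" "X \<in> Obj C" "Y \<in> Obj C"
  using assms Dom_Obj Cod_Obj by (auto simp: hom_def)

lemma homI: "f \<in> Arr C \<Longrightarrow> Dom C f = X \<Longrightarrow> Cod C f = Y \<Longrightarrow> f \<in> hom C X Y"
  by (simp add: hom_def)

lemma Ide_simps [simp]:
  assumes "X \<in> Obj C"
  shows "Ide C X \<in> Arr C" "Dom C (Ide C X) = X" "Cod C (Ide C X) = X"
  using Ide_hom[OF assms] by (auto simp: hom_def)

lemma Comp_simps [simp]:
  assumes "f \<in> Arr C" "g \<in> Arr C" "Cod C f = Dom C g"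
  shows "g \<cdot> f \<in> Arr C" "Dom C (g \<cdot> f) = Dom C f" "Cod C (g \<cdot> f) = Cod C g"
  using Comp_hom[of f "Dom C f" "Cod C f" g "Cod C g"] assms by (auto simp: hom_def)

lemma assoc [simp]:
  assumes "f \<in> Arr C" "g \<in> Arr C" "h \<in> Arr C" "Cod C f = Dom C g" "Cod C g = Dom C h"
  shows "(h \<cdot> g) \<cdot> f = h \<cdot> (g \<cdot> f)"
  using Comp_assoc[of f "Dom C f" "Cod C f" g "Cod C g" h "Cod C h"] assms by (auto simp: hom_def)

lemma unit_simps [simp]:
  assumes "f \<in> Arr C"
  shows "Dom C f = X \<Longrightarrow> f \<cdot> Ide C X = f" "Cod C f = X \<Longrightarrow> Ide C X \<cdot> f = f"
  using Comp_Ide Ide_Comp assms by (auto simp: hom_def)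

text \<open>With composites normalized to the right, an equation between composites of two arrows
  rewrites longer composites only in this form.\<close>

lemma comp_ext:
  assumes "g \<cdot> f = k" "f \<in> Arr C" "g \<in> Arr C" "Cod C f = Dom C g" "x \<in> Arr C" "Cod C x = Dom C f"
  shows "g \<cdot> (f \<cdot> x) = k \<cdot> x"
  using assms by (metis assoc)

lemma liftsE:
  assumes "lifts C i p" "i \<in> hom C A B" "p \<in> hom C X Y" "u \<in> hom C A X" "v \<in> hom C B Y"
    "p \<cdot> u = v \<cdot> i"
  obtains h where "h \<in> hom C B X" "h \<cdot> i = u" "p \<cdot> h = v"
proof -
  have "\<exists>h \<in> hom C B X. h \<cdot> i = u \<and> p \<cdot> h = v"
    using assms(1,4-6) homD(2,3)[OF assms(2)] homD(2,3)[OF assms(3)] by (simp add: lifts_def)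
  then show ?thesis using that by blast
qed

lemma liftsI:
  assumes "i \<in> hom C A B" "p \<in> hom C X Y"
    "\<And>u v. u \<in> hom C A X \<Longrightarrow> v \<in> hom C B Y \<Longrightarrow> p \<cdot> u = v \<cdot> i
      \<Longrightarrow> \<exists>h \<in> hom C B X. h \<cdot> i = u \<and> p \<cdot> h = v"
  shows "lifts C i p"
  using assms(3) homD(2,3)[OF assms(1)] homD(2,3)[OF assms(2)] by (simp add: lifts_def)

lemma lifts_comp_left:
  assumes "lifts C i p" "lifts C j p" "i \<in> hom C A B" "j \<in> hom C B D" "p \<in> Arr C"
  shows "lifts C (j \<cdot> i) p"
proof (rule liftsI)
  show p: "p \<in> hom C (Dom C p) (Cod C p)" using assms(5) by (rule homI) auto
  show "j \<cdot> i \<in> hom C A D" using assms by (auto intro: Comp_hom)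
  fix u v assume u: "u \<in> hom C A (Dom C p)" and v: "v \<in> hom C D (Cod C p)"
    and eq: "p \<cdot> u = v \<cdot> (j \<cdot> i)"
  have "p \<cdot> u = (v \<cdot> j) \<cdot> i" using eq assms v by (simp add: hom_def)
  then obtain h where h: "h \<in> hom C B (Dom C p)" "h \<cdot> i = u" "p \<cdot> h = v \<cdot> j"
    using liftsE[OF assms(1,3) p u] Comp_hom[OF assms(4) v] by metis
  obtain k where k: "k \<in> hom C D (Dom C p)" "k \<cdot> j = h" "p \<cdot> k = v"
    using liftsE[OF assms(2,4) p h(1) v h(3)] by metis
  have "k \<cdot> (j \<cdot> i) = u" using k h assms by (simp add: hom_def flip: assoc)
  then show "\<exists>h\<in>hom C D (Dom C p). h \<cdot> (j \<cdot> i) = u \<and> p \<cdot> h = v" using k by blast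
qed

lemma lifts_comp_right:
  assumes "lifts C i p" "lifts C i q" "p \<in> hom C X Y" "q \<in> hom C Y Z" "i \<in> Arr C"
  shows "lifts C i (q \<cdot> p)"
proof (rule liftsI)
  show i: "i \<in> hom C (Dom C i) (Cod C i)" using assms(5) by (rule homI) auto
  show "q \<cdot> p \<in> hom C X Z" using assms by (auto intro: Comp_hom)
  fix u v assume u: "u \<in> hom C (Dom C i) X" and v: "v \<in> hom C (Cod C i) Z"
    and eq: "(q \<cdot> p) \<cdot> u = v \<cdot> i"
  have "q \<cdot> (p \<cdot> u) = v \<cdot> i" using eq assms u by (simp add: hom_def)
  then obtain h where h: "h \<in> hom C (Cod C i) Y" "h \<cdot> i = p \<cdot> u" "q \<cdot> h = v"
    using liftsE[OF assms(2) i assms(4) _ v] Comp_hom[OF u assms(3)] by metis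
  obtain k where k: "k \<in> hom C (Cod C i) X" "k \<cdot> i = u" "p \<cdot> k = h"
    using liftsE[OF assms(1) i assms(3) u h(1)] h(2) by metis
  have "(q \<cdot> p) \<cdot> k = v" using k h assms by (simp add: hom_def)
  then show "\<exists>h\<in>hom C (Cod C i) X. h \<cdot> i = u \<and> (q \<cdot> p) \<cdot> h = v" using k by blast
qed

lemma lifts_retract_left:
  assumes "retract_of C i j" "lifts C j p" "p \<in> Arr C"
  shows "lifts C i p"
proof -
  obtain s r s' r' where
    i: "i \<in> Arr C" and j: "j \<in> Arr C" and
    s: "s \<in> hom C (Dom C i) (Dom C j)" and r: "r \<in> hom C (Dom C j) (Dom C i)" and
    s': "s' \<in> hom C (Cod C i) (Cod C j)" and r': "r' \<in> hom C (Cod C j) (Cod C i)" and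
    eq: "r \<cdot> s = Ide C (Dom C i)" "r' \<cdot> s' = Ide C (Cod C i)" "j \<cdot> s = s' \<cdot> i" "i \<cdot> r = r' \<cdot> j"
    using assms(1) unfolding retract_of_def by blast
  show ?thesis
  proof (rule liftsI[of _ "Dom C i" "Cod C i" _ "Dom C p" "Cod C p"])
    show ih: "i \<in> hom C (Dom C i) (Cod C i)" and p: "p \<in> hom C (Dom C p) (Cod C p)"
      using i assms(3) by (auto simp: hom_def)
    have jh: "j \<in> hom C (Dom C j) (Cod C j)" using j by (auto simp: hom_def)
    fix u v assume u: "u \<in> hom C (Dom C i) (Dom C p)" and v: "v \<in> hom C (Cod C i) (Cod C p)"
      and sq: "p \<cdot> u = v \<cdot> i"
    have "p \<cdot> (u \<cdot> r) = (v \<cdot> r') \<cdot> j"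
      using u v ih jh p r r' by (simp add: hom_def comp_ext[OF sq] eq)
    then obtain h where h: "h \<in> hom C (Cod C j) (Dom C p)" "h \<cdot> j = u \<cdot> r" "p \<cdot> h = v \<cdot> r'"
      using liftsE[OF assms(2) jh p Comp_hom[OF r u] Comp_hom[OF r' v]] by metis
    have "(h \<cdot> s') \<cdot> i = u"
      using u h ih jh s s' r
      by (simp add: hom_def eq(3)[symmetric] comp_ext[OF h(2)] eq(1))
    moreover have "p \<cdot> (h \<cdot> s') = v"
      using v h p s' r' by (simp add: hom_def comp_ext[OF h(3)] eq)
    ultimately show "\<exists>h\<in>hom C (Cod C i) (Dom C p). h \<cdot> i = u \<and> p \<cdot> h = v"
      using Comp_hom[OF s' h(1)] by blast
  qed
qed

lemma lifts_retract_right: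
  assumes "retract_of C p q" "lifts C i q" "i \<in> Arr C"
  shows "lifts C i p"
proof -
  obtain s r s' r' where
    p: "p \<in> Arr C" and q: "q \<in> Arr C" and
    s: "s \<in> hom C (Dom C p) (Dom C q)" and r: "r \<in> hom C (Dom C q) (Dom C p)" and
    s': "s' \<in> hom C (Cod C p) (Cod C q)" and r': "r' \<in> hom C (Cod C q) (Cod C p)" and
    eq: "r \<cdot> s = Ide C (Dom C p)" "r' \<cdot> s' = Ide C (Cod C p)" "q \<cdot> s = s' \<cdot> p" "p \<cdot> r = r' \<cdot> q"
    using assms(1) unfolding retract_of_def by blast
  show ?thesis
  proof (rule liftsI[of _ "Dom C i" "Cod C i" _ "Dom C p" "Cod C p"])
    show ih: "i \<in> hom C (Dom C i) (Cod C i)" and ph: "p \<in> hom C (Dom C p) (Cod C p)"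
      using p assms(3) by (auto simp: hom_def)
    have qh: "q \<in> hom C (Dom C q) (Cod C q)" using q by (auto simp: hom_def)
    fix u v assume u: "u \<in> hom C (Dom C i) (Dom C p)" and v: "v \<in> hom C (Cod C i) (Cod C p)"
      and sq: "p \<cdot> u = v \<cdot> i"
    have "q \<cdot> (s \<cdot> u) = (s' \<cdot> v) \<cdot> i"
      using u v ih qh ph s s' by (simp add: hom_def comp_ext[OF eq(3)] sq)
    then obtain h where h: "h \<in> hom C (Cod C i) (Dom C q)" "h \<cdot> i = s \<cdot> u" "q \<cdot> h = s' \<cdot> v"
      using liftsE[OF assms(2) ih qh Comp_hom[OF u s] Comp_hom[OF v s']] by metis
    have "(r \<cdot> h) \<cdot> i = u"
      using u h ih s r by (simp add: hom_def comp_ext[OF eq(1)])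
    moreover have "p \<cdot> (r \<cdot> h) = v"
      using v h ph qh r r' s' by (simp add: hom_def comp_ext[OF eq(4)] comp_ext[OF eq(2)])
    ultimately show "\<exists>h\<in>hom C (Cod C i) (Dom C p). h \<cdot> i = u \<and> p \<cdot> h = v"
      using Comp_hom[OF h(1) r] by blast
  qed
qed

lemma lifts_Ide_left:
  assumes "A \<in> Obj C" "p \<in> Arr C"
  shows "lifts C (Ide C A) p"
proof (rule liftsI)
  show "p \<in> hom C (Dom C p) (Cod C p)" "Ide C A \<in> hom C A A" using assms Ide_hom by (auto simp: hom_def)
  fix u v assume *: "u \<in> hom C A (Dom C p)" "v \<in> hom C A (Cod C p)" "p \<cdot> u = v \<cdot> Ide C A"
  then have "p \<cdot> u = v" "u \<cdot> Ide C A = u" by (auto simp: hom_def)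
  with * show "\<exists>h\<in>hom C A (Dom C p). h \<cdot> Ide C A = u \<and> p \<cdot> h = v" by blast
qed

lemma lifts_Ide_right:
  assumes "X \<in> Obj C" "i \<in> Arr C"
  shows "lifts C i (Ide C X)"
proof (rule liftsI)
  show "i \<in> hom C (Dom C i) (Cod C i)" "Ide C X \<in> hom C X X" using assms Ide_hom by (auto simp: hom_def)
  fix u v assume *: "u \<in> hom C (Dom C i) X" "v \<in> hom C (Cod C i) X" "Ide C X \<cdot> u = v \<cdot> i"
  then have "v \<cdot> i = u" "Ide C X \<cdot> v = v" by (auto simp: hom_def)
  with * show "\<exists>h\<in>hom C (Cod C i) X. h \<cdot> i = u \<and> Ide C X \<cdot> h = v" by blast
qed

lemma pushoutE:
  assumes "is_pushout C f g i j"
  obtains X Y Z P where "f \<in> hom C Z X" "g \<in> hom C Z Y" "i \<in> hom C X P" "j \<in> hom C Y P"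
    "i \<cdot> f = j \<cdot> g"
    "\<And>Q u v. u \<in> hom C X Q \<Longrightarrow> v \<in> hom C Y Q \<Longrightarrow> u \<cdot> f = v \<cdot> g
      \<Longrightarrow> \<exists>h \<in> hom C P Q. h \<cdot> i = u \<and> h \<cdot> j = v"
    "\<And>Q x y. x \<in> hom C P Q \<Longrightarrow> y \<in> hom C P Q \<Longrightarrow> x \<cdot> i = y \<cdot> i \<Longrightarrow> x \<cdot> j = y \<cdot> j \<Longrightarrow> x = y"
proof -
  obtain X Y Z P where f: "f \<in> hom C Z X" and g: "g \<in> hom C Z Y" and
    i: "i \<in> hom C X P" and j: "j \<in> hom C Y P" and sq: "i \<cdot> f = j \<cdot> g" and
    univ: "\<And>Q u v. u \<in> hom C X Q \<Longrightarrow> v \<in> hom C Y Q \<Longrightarrow> u \<cdot> f = v \<cdot> g \<Longrightarrow>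
           (\<exists>!h. h \<in> hom C P Q \<and> h \<cdot> i = u \<and> h \<cdot> j = v)"
    using assms unfolding is_pushout_def by blast
  have "x = y" if *: "x \<in> hom C P Q" "y \<in> hom C P Q" "x \<cdot> i = y \<cdot> i" "x \<cdot> j = y \<cdot> j" for Q x y
  proof -
    have "(x \<cdot> i) \<cdot> f = (x \<cdot> j) \<cdot> g"
      using homD[OF *(1)] homD[OF i] homD[OF j] homD[OF f] homD[OF g] by (simp add: sq)
    from univ[OF Comp_hom[OF i *(1)] Comp_hom[OF j *(1)] this] * show ?thesis by metis
  qed
  moreover have "\<exists>h \<in> hom C P Q. h \<cdot> i = u \<and> h \<cdot> j = v"
    if "u \<in> hom C X Q" "v \<in> hom C Y Q" "u \<cdot> f = v \<cdot> g" for Q u v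
    using univ[OF that] by blast
  ultimately show ?thesis using that[OF f g i j sq] by blast
qed

lemma pullbackE:
  assumes "is_pullback C f g p q"
  obtains X Y Z P where "f \<in> hom C X Z" "g \<in> hom C Y Z" "p \<in> hom C P X" "q \<in> hom C P Y"
    "f \<cdot> p = g \<cdot> q"
    "\<And>Q u v. u \<in> hom C Q X \<Longrightarrow> v \<in> hom C Q Y \<Longrightarrow> f \<cdot> u = g \<cdot> v
      \<Longrightarrow> \<exists>h \<in> hom C Q P. p \<cdot> h = u \<and> q \<cdot> h = v"
    "\<And>Q x y. x \<in> hom C Q P \<Longrightarrow> y \<in> hom C Q P \<Longrightarrow> p \<cdot> x = p \<cdot> y \<Longrightarrow> q \<cdot> x = q \<cdot> y \<Longrightarrow> x = y"
proof -
  obtain X Y Z P where f: "f \<in> hom C X Z" and g: "g \<in> hom C Y Z" and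
    p: "p \<in> hom C P X" and q: "q \<in> hom C P Y" and sq: "f \<cdot> p = g \<cdot> q" and
    univ: "\<And>Q u v. u \<in> hom C Q X \<Longrightarrow> v \<in> hom C Q Y \<Longrightarrow> f \<cdot> u = g \<cdot> v \<Longrightarrow>
           (\<exists>!h. h \<in> hom C Q P \<and> p \<cdot> h = u \<and> q \<cdot> h = v)"
    using assms unfolding is_pullback_def by blast
  have "x = y" if *: "x \<in> hom C Q P" "y \<in> hom C Q P" "p \<cdot> x = p \<cdot> y" "q \<cdot> x = q \<cdot> y" for Q x y
  proof -
    have "f \<cdot> (p \<cdot> x) = g \<cdot> (q \<cdot> x)"
      using homD[OF *(1)] homD[OF p] homD[OF q] homD[OF f] homD[OF g]
      by (simp add: comp_ext[OF sq])
    from univ[OF Comp_hom[OF *(1) p] Comp_hom[OF *(1) q] this] * show ?thesis by metis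
  qed
  moreover have "\<exists>h \<in> hom C Q P. p \<cdot> h = u \<and> q \<cdot> h = v"
    if "u \<in> hom C Q X" "v \<in> hom C Q Y" "f \<cdot> u = g \<cdot> v" for Q u v
    using univ[OF that] by blast
  ultimately show ?thesis using that[OF f g p q sq] by blast
qed

lemma lifts_pushout:
  assumes "is_pushout C f g i j" "lifts C g p" "p \<in> Arr C"
  shows "lifts C i p"
proof -
  obtain X Y Z P where f: "f \<in> hom C Z X" and g: "g \<in> hom C Z Y" and
    i: "i \<in> hom C X P" and j: "j \<in> hom C Y P" and sq: "i \<cdot> f = j \<cdot> g" and
    ex: "\<And>Q u v. u \<in> hom C X Q \<Longrightarrow> v \<in> hom C Y Q \<Longrightarrow> u \<cdot> f = v \<cdot> g
      \<Longrightarrow> \<exists>h \<in> hom C P Q. h \<cdot> i = u \<and> h \<cdot> j = v" and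
    uniq: "\<And>Q x y. x \<in> hom C P Q \<Longrightarrow> y \<in> hom C P Q \<Longrightarrow> x \<cdot> i = y \<cdot> i \<Longrightarrow> x \<cdot> j = y \<cdot> j \<Longrightarrow> x = y"
    using pushoutE[OF assms(1)] by metis
  show ?thesis
  proof (rule liftsI[OF i])
    show p: "p \<in> hom C (Dom C p) (Cod C p)" using assms by (simp add: hom_def)
    fix u v assume u: "u \<in> hom C X (Dom C p)" and v: "v \<in> hom C P (Cod C p)"
      and e: "p \<cdot> u = v \<cdot> i"
    have "p \<cdot> (u \<cdot> f) = (v \<cdot> j) \<cdot> g"
      using homD[OF f] homD[OF g] homD[OF i] homD[OF j] homD[OF p] homD[OF u] homD[OF v]
      by (simp add: comp_ext[OF e] sq)
    then obtain h where h: "h \<in> hom C Y (Dom C p)" "h \<cdot> g = u \<cdot> f" "p \<cdot> h = v \<cdot> j"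
      using liftsE[OF assms(2) g p Comp_hom[OF f u] Comp_hom[OF j v]] by metis
    obtain k where k: "k \<in> hom C P (Dom C p)" "k \<cdot> i = u" "k \<cdot> j = h"
      using ex[OF u h(1) h(2)[symmetric]] by blast
    have "(p \<cdot> k) \<cdot> i = v \<cdot> i" "(p \<cdot> k) \<cdot> j = v \<cdot> j"
      using homD[OF i] homD[OF j] homD[OF p] homD[OF k(1)] by (simp_all add: k e h)
    then have "p \<cdot> k = v" using uniq[OF Comp_hom[OF k(1) p] v] by blast
    then show "\<exists>h\<in>hom C P (Dom C p). h \<cdot> i = u \<and> p \<cdot> h = v" using k by blast
  qed
qed

lemma lifts_pullback:
  assumes "is_pullback C p f q p'" "lifts C i p" "i \<in> Arr C"
  shows "lifts C i p'"
proof -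
  obtain X Y Z P where p: "p \<in> hom C X Z" and f: "f \<in> hom C Y Z" and
    q: "q \<in> hom C P X" and p': "p' \<in> hom C P Y" and sq: "p \<cdot> q = f \<cdot> p'" and
    ex: "\<And>Q u v. u \<in> hom C Q X \<Longrightarrow> v \<in> hom C Q Y \<Longrightarrow> p \<cdot> u = f \<cdot> v
      \<Longrightarrow> \<exists>h \<in> hom C Q P. q \<cdot> h = u \<and> p' \<cdot> h = v" and
    uniq: "\<And>Q x y. x \<in> hom C Q P \<Longrightarrow> y \<in> hom C Q P \<Longrightarrow> q \<cdot> x = q \<cdot> y \<Longrightarrow> p' \<cdot> x = p' \<cdot> y \<Longrightarrow> x = y"
    using pullbackE[OF assms(1)] by metis
  show ?thesis
  proof (rule liftsI[OF _ p'])
    show i: "i \<in> hom C (Dom C i) (Cod C i)" using assms by (simp add: hom_def)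
    fix u v assume u: "u \<in> hom C (Dom C i) P" and v: "v \<in> hom C (Cod C i) Y"
      and e: "p' \<cdot> u = v \<cdot> i"
    have "p \<cdot> (q \<cdot> u) = (f \<cdot> v) \<cdot> i"
      using homD[OF p] homD[OF f] homD[OF q] homD[OF p'] homD[OF u] homD[OF v] homD[OF i]
      by (simp add: comp_ext[OF sq] e)
    then obtain h where h: "h \<in> hom C (Cod C i) X" "h \<cdot> i = q \<cdot> u" "p \<cdot> h = f \<cdot> v"
      using liftsE[OF assms(2) i p Comp_hom[OF u q] Comp_hom[OF v f]] by metis
    obtain k where k: "k \<in> hom C (Cod C i) P" "q \<cdot> k = h" "p' \<cdot> k = v"
      using ex[OF h(1) v h(3)] by blast
    have "q \<cdot> (k \<cdot> i) = q \<cdot> u" "p' \<cdot> (k \<cdot> i) = p' \<cdot> u"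
      using homD[OF q] homD[OF p'] homD[OF k(1)] homD[OF i]
      by (simp_all add: comp_ext[OF k(2)] comp_ext[OF k(3)] h e)
    then have "k \<cdot> i = u" using uniq[OF Comp_hom[OF i k(1)] u] by blast
    then show "\<exists>h\<in>hom C (Cod C i) P. h \<cdot> i = u \<and> p' \<cdot> h = v" using k by blast
  qed
qed

lemma retract_ofI_left:
  assumes "i \<in> hom C A B" "j \<in> hom C A E" "k \<in> hom C B E" "m \<in> hom C E B"
    "k \<cdot> i = j" "m \<cdot> k = Ide C B"
  shows "retract_of C i j"
proof -
  have "m \<cdot> (k \<cdot> i) = i"
    using homD[OF assms(1)] homD[OF assms(3)] homD[OF assms(4)] by (simp add: comp_ext[OF assms(6)])
  then have "m \<cdot> j = i" by (simp only: assms(5))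
  moreover have "Ide C A \<in> hom C A A" using homD(4)[OF assms(1)] by (rule Ide_hom)
  moreover have "Ide C A \<cdot> Ide C A = Ide C A" using homD(4)[OF assms(1)] by simp
  ultimately show ?thesis
    unfolding retract_of_def using assms homD[OF assms(1)] homD[OF assms(2)]
    by (intro conjI exI[of _ "Ide C A"] exI[of _ k] exI[of _ m]) simp_all
qed

lemma retract_ofI_right:
  assumes "p \<in> hom C X Y" "q \<in> hom C E Y" "k \<in> hom C X E" "m \<in> hom C E X"
    "p \<cdot> m = q" "m \<cdot> k = Ide C X"
  shows "retract_of C p q"
proof -
  have "(p \<cdot> m) \<cdot> k = p"
    using homD[OF assms(1)] homD[OF assms(3)] homD[OF assms(4)] by (simp add: assms(6))
  then have "q \<cdot> k = p" by (simp only: assms(5))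
  moreover have "Ide C Y \<in> hom C Y Y" using homD(5)[OF assms(1)] by (rule Ide_hom)
  moreover have "Ide C Y \<cdot> Ide C Y = Ide C Y" using homD(5)[OF assms(1)] by simp
  ultimately show ?thesis
    unfolding retract_of_def using assms homD[OF assms(1)] homD[OF assms(2)]
    by (intro conjI exI[of _ "Ide C Y"] exI[of _ k] exI[of _ m]) simp_all
qed

text \<open>The retract argument, in its two dual forms.\<close>

lemma retract_argument_left:
  assumes "l \<in> hom C X E" "r \<in> hom C E Y" "f = r \<cdot> l" "lifts C f r"
  shows "retract_of C f l"
proof -
  have f: "f \<in> hom C X Y" using assms Comp_hom by blast
  have Y: "Ide C Y \<in> hom C Y Y" using homD(5)[OF f] by (rule Ide_hom)
  have "r \<cdot> l = Ide C Y \<cdot> f" using f assms by (simp add: hom_def)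
  then obtain h where "h \<in> hom C Y E" "h \<cdot> f = l" "r \<cdot> h = Ide C Y"
    using liftsE[OF assms(4) f assms(2,1) Y] by metis
  then show ?thesis using retract_ofI_left[OF f assms(1) _ assms(2)] by blast
qed

lemma retract_argument_right:
  assumes "l \<in> hom C X E" "r \<in> hom C E Y" "f = r \<cdot> l" "lifts C l f"
  shows "retract_of C f r"
proof -
  have f: "f \<in> hom C X Y" using assms Comp_hom by blast
  have X: "Ide C X \<in> hom C X X" using homD(4)[OF f] by (rule Ide_hom)
  have "f \<cdot> Ide C X = r \<cdot> l" using f assms by (simp add: hom_def)
  then obtain h where "h \<in> hom C E X" "h \<cdot> l = Ide C X" "f \<cdot> h = r"
    using liftsE[OF assms(4,1) f X assms(2)] by metis
  then show ?thesis using retract_ofI_right[OF f assms(2,1)] by blast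
qed

end

section \<open>Weak factorization systems\<close>

context category
begin

lemma wfs_left_iff: "wfs C L R \<Longrightarrow> i \<in> L \<longleftrightarrow> i \<in> Arr C \<and> (\<forall>p \<in> R. lifts C i p)"
  unfolding wfs_def by blast

lemma wfs_right_iff: "wfs C L R \<Longrightarrow> p \<in> R \<longleftrightarrow> p \<in> Arr C \<and> (\<forall>i \<in> L. lifts C i p)"
  unfolding wfs_def by blast

lemma wfs_lifts: "wfs C L R \<Longrightarrow> i \<in> L \<Longrightarrow> p \<in> R \<Longrightarrow> lifts C i p"
  unfolding wfs_left_iff by blast

lemma wfs_left_Arr: "wfs C L R \<Longrightarrow> i \<in> L \<Longrightarrow> i \<in> Arr C"
  unfolding wfs_left_iff by blast

lemma wfs_right_Arr: "wfs C L R \<Longrightarrow> p \<in> R \<Longrightarrow> p \<in> Arr C"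
  unfolding wfs_right_iff by blast

lemma wfs_leftI: "wfs C L R \<Longrightarrow> i \<in> Arr C \<Longrightarrow> (\<And>p. p \<in> R \<Longrightarrow> lifts C i p) \<Longrightarrow> i \<in> L"
  unfolding wfs_left_iff by blast

lemma wfs_rightI: "wfs C L R \<Longrightarrow> p \<in> Arr C \<Longrightarrow> (\<And>i. i \<in> L \<Longrightarrow> lifts C i p) \<Longrightarrow> p \<in> R"
  unfolding wfs_right_iff by blast

lemma wfs_factorE:
  assumes "wfs C L R" "f \<in> hom C X Y"
  obtains E l r where "l \<in> L" "r \<in> R" "l \<in> hom C X E" "r \<in> hom C E Y" "f = r \<cdot> l"
proof -
  have "factors_as C L R f" using assms homD(1)[OF assms(2)] unfolding wfs_def by blast
  then obtain l r where lr: "l \<in> L" "r \<in> R" "l \<in> Arr C" "r \<in> Arr C" "Cod C l = Dom C r" "f = r \<cdot> l"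
    unfolding factors_as_def by blast
  then have "l \<in> hom C X (Dom C r)" "r \<in> hom C (Dom C r) Y"
    using homD[OF assms(2)] by (auto simp: hom_def)
  with lr that show ?thesis by blast
qed

lemma wfs_left_comp:
  assumes "wfs C L R" "i \<in> L" "j \<in> L" "i \<in> hom C A B" "j \<in> hom C B D"
  shows "j \<cdot> i \<in> L"
proof (rule wfs_leftI[OF assms(1)])
  show "j \<cdot> i \<in> Arr C" using homD[OF assms(4)] homD[OF assms(5)] by simp
  fix p assume "p \<in> R"
  then show "lifts C (j \<cdot> i) p"
    using wfs_lifts[OF assms(1)] wfs_right_Arr[OF assms(1)] assms(2,3)
    by (intro lifts_comp_left[OF _ _ assms(4,5)]) auto
qed

lemma wfs_right_comp:
  assumes "wfs C L R" "p \<in> R" "q \<in> R" "p \<in> hom C X Y" "q \<in> hom C Y Z"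
  shows "q \<cdot> p \<in> R"
proof (rule wfs_rightI[OF assms(1)])
  show "q \<cdot> p \<in> Arr C" using homD[OF assms(4)] homD[OF assms(5)] by simp
  fix i assume "i \<in> L"
  then show "lifts C i (q \<cdot> p)"
    using wfs_lifts[OF assms(1)] wfs_left_Arr[OF assms(1)] assms(2,3)
    by (intro lifts_comp_right[OF _ _ assms(4,5)]) auto
qed

lemma wfs_left_retract:
  assumes "wfs C L R" "retract_of C i j" "j \<in> L"
  shows "i \<in> L"
proof (rule wfs_leftI[OF assms(1)])
  show "i \<in> Arr C" using assms(2) by (simp add: retract_of_def)
  fix p assume "p \<in> R"
  then show "lifts C i p"
    using lifts_retract_left[OF assms(2)] wfs_lifts[OF assms(1,3)] wfs_right_Arr[OF assms(1)] by blast
qed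

lemma wfs_right_retract:
  assumes "wfs C L R" "retract_of C p q" "q \<in> R"
  shows "p \<in> R"
proof (rule wfs_rightI[OF assms(1)])
  show "p \<in> Arr C" using assms(2) by (simp add: retract_of_def)
  fix i assume "i \<in> L"
  then show "lifts C i p"
    using lifts_retract_right[OF assms(2)] wfs_lifts[OF assms(1) _ assms(3)] wfs_left_Arr[OF assms(1)]
    by blast
qed

lemma wfs_right_Ide: "wfs C L R \<Longrightarrow> X \<in> Obj C \<Longrightarrow> Ide C X \<in> R"
  by (rule wfs_rightI) (auto intro: lifts_Ide_right dest: wfs_left_Arr)

lemma wfs_left_Ide: "wfs C L R \<Longrightarrow> X \<in> Obj C \<Longrightarrow> Ide C X \<in> L"
  by (rule wfs_leftI) (auto intro: lifts_Ide_left dest: wfs_right_Arr)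

lemma wfs_left_pushout:
  assumes "wfs C L R" "is_pushout C f g i j" "g \<in> L"
  shows "i \<in> L"
proof (rule wfs_leftI[OF assms(1)])
  show "i \<in> Arr C" using assms(2) by (auto simp: is_pushout_def hom_def)
  fix p assume "p \<in> R"
  then show "lifts C i p"
    using lifts_pushout[OF assms(2)] wfs_lifts[OF assms(1,3)] wfs_right_Arr[OF assms(1)] by blast
qed

lemma wfs_right_pullback:
  assumes "wfs C L R" "is_pullback C p f q p'" "p \<in> R"
  shows "p' \<in> R"
proof (rule wfs_rightI[OF assms(1)])
  show "p' \<in> Arr C" using assms(2) by (auto simp: is_pullback_def hom_def)
  fix i assume "i \<in> L"
  then show "lifts C i p'"
    using lifts_pullback[OF assms(2)] wfs_lifts[OF assms(1) _ assms(3)] wfs_left_Arr[OF assms(1)]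
    by blast
qed

lemma is_pullback_sym:
  assumes "is_pullback C f g p q"
  shows "is_pullback C g f q p"
proof -
  obtain X Y Z P where *: "f \<in> hom C X Z" "g \<in> hom C Y Z" "p \<in> hom C P X" "q \<in> hom C P Y"
    "f \<cdot> p = g \<cdot> q" and
    univ: "\<forall>Q. \<forall>u \<in> hom C Q X. \<forall>v \<in> hom C Q Y. f \<cdot> u = g \<cdot> v \<longrightarrow>
           (\<exists>!h. h \<in> hom C Q P \<and> p \<cdot> h = u \<and> q \<cdot> h = v)"
    using assms unfolding is_pullback_def by blast
  show ?thesis
    unfolding is_pullback_def
  proof (intro exI conjI allI ballI impI)
    show "g \<in> hom C Y Z" "f \<in> hom C X Z" "q \<in> hom C P Y" "p \<in> hom C P X" "g \<cdot> q = f \<cdot> p"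
      using * by auto
    fix Q u v assume "u \<in> hom C Q Y" "v \<in> hom C Q X" "g \<cdot> u = f \<cdot> v"
    then have "\<exists>!h. h \<in> hom C Q P \<and> p \<cdot> h = v \<and> q \<cdot> h = u" using univ by simp
    then show "\<exists>!h. h \<in> hom C Q P \<and> q \<cdot> h = u \<and> p \<cdot> h = v" by (simp add: conj_commute)
  qed
qed

end


section \<open>Finite limits and colimits from the small ones\<close>

context
  fixes C :: "('o, 'a, 'm) category_scheme" (structure) and K :: "'k itself"
  assumes cat: "category C" and inf: "infinite (UNIV :: 'k set)"
begin

interpretation category C by (rule cat)

lemma finite_small: "finite (Arr (J :: ('k, 'k) category)) \<Longrightarrow> small J"
  using finite_lesspoll_infinite[OF inf] by (simp add: small_def)

lemma ex_initial:
  assumes "cocomplete K C"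
  obtains Z where "is_initial C Z"
proof -
  define J :: "('k, 'k) category" where
    "J = \<lparr>Obj = {}, Arr = {}, Dom = id, Cod = id, Ide = id, Comp = \<lambda>g f. f\<rparr>"
  have "category J" "small J" "is_functor J C undefined undefined"
    using finite_small by (auto simp: J_def category_def hom_def is_functor_def)
  then obtain L l where L: "is_colimit J C undefined undefined L l"
    using assms unfolding cocomplete_def by blast
  have "is_initial C L"
    using L by (simp add: is_initial_def is_colimit_def is_cocone_def J_def)
  then show ?thesis by (rule that)
qed

lemma ex_terminal:
  assumes "complete K C"
  obtains T where "is_terminal C T"
proof -
  define J :: "('k, 'k) category" where
    "J = \<lparr>Obj = {}, Arr = {}, Dom = id, Cod = id, Ide = id, Comp = \<lambda>g f. f\<rparr>"
  have "category J" "small J" "is_functor J C undefined undefined"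
    using finite_small by (auto simp: J_def category_def hom_def is_functor_def)
  then obtain L l where L: "is_limit J C undefined undefined L l"
    using assms unfolding complete_def by blast
  have "is_terminal C L"
    using L by (simp add: is_terminal_def is_limit_def is_cone_def J_def)
  then show ?thesis by (rule that)
qed

lemma ex_five_distinct:
  obtains a b c u v :: 'k where "distinct [a, b, c, u, v]"
proof -
  obtain e :: "nat \<Rightarrow> 'k" where "inj e" using infinite_countable_subset[OF inf] by blast
  then have "distinct (map e [0, 1, 2, 3, 4])" by (simp add: inj_eq)
  then show ?thesis using that by simp
qed

lemma ex_pushout:
  assumes "cocomplete K C" "f \<in> hom C Z X" "g \<in> hom C Z Y"
  obtains i j where "is_pushout C f g i j"
proof -
  obtain a b c u v :: 'k where d: "distinct [a, b, c, u, v]" by (rule ex_five_distinct)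
  \<comment> \<open>The span \<open>b \<leftarrow> a \<rightarrow> c\<close>, whose objects serve as their own identities.\<close>
  define J :: "('k, 'k) category" where
    "J = \<lparr>Obj = {a, b, c}, Arr = {a, b, c, u, v}, Dom = \<lambda>x. if x = u \<or> x = v then a else x,
      Cod = \<lambda>x. if x = u then b else if x = v then c else x, Ide = id,
      Comp = \<lambda>g f. if f = u \<or> f = v then f else g\<rparr>"
  define Fo where "Fo = (\<lambda>x. if x = a then Z else if x = b then X else Y)"
  define Fa where "Fa = (\<lambda>x. if x = u then f else if x = v then g else Ide C (Fo x))"
  have J: "category J" using d by unfold_locales (auto simp: J_def hom_def split: if_splits)
  have "is_functor J C Fo Fa"
    using d homD[OF assms(2)] homD[OF assms(3)]
    by (auto simp: is_functor_def J_def Fo_def Fa_def hom_def)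
  moreover have "small J" by (rule finite_small) (simp add: J_def)
  ultimately obtain P l where P: "is_colimit J C Fo Fa P l"
    using J assms unfolding cocomplete_def by blast
  have l: "l a \<in> hom C Z P" "l b \<in> hom C X P" "l c \<in> hom C Y P" "l b \<cdot> f = l a" "l c \<cdot> g = l a"
    using P d by (auto simp: is_colimit_def is_cocone_def J_def Fo_def Fa_def)
  have "is_pushout C f g (l b) (l c)"
    unfolding is_pushout_def
  proof (intro exI conjI allI ballI impI)
    show "f \<in> hom C Z X" "g \<in> hom C Z Y" "l b \<in> hom C X P" "l c \<in> hom C Y P" "l b \<cdot> f = l c \<cdot> g"
      using assms l by auto
    fix Q s t assume s: "s \<in> hom C X Q" and t: "t \<in> hom C Y Q" and st: "s \<cdot> f = t \<cdot> g"
    define k where "k = (\<lambda>x. if x = a then s \<cdot> f else if x = b then s else t)"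
    have "is_cocone J C Fo Fa Q k"
      using d s t homD[OF s] homD[OF t] homD[OF assms(2)] homD[OF assms(3)] st
        Comp_hom[OF assms(2) s] Comp_hom[OF assms(3) t]
      by (auto simp: is_cocone_def J_def Fo_def Fa_def k_def)
    then have ex: "\<exists>!h. h \<in> hom C P Q \<and> (\<forall>i \<in> Obj J. h \<cdot> l i = k i)"
      using P by (simp add: is_colimit_def)
    have "(h \<in> hom C P Q \<and> (\<forall>i \<in> Obj J. h \<cdot> l i = k i)) \<longleftrightarrow>
        (h \<in> hom C P Q \<and> h \<cdot> l b = s \<and> h \<cdot> l c = t)" for h
    proof -
      have "h \<cdot> l a = s \<cdot> f" if "h \<in> hom C P Q" "h \<cdot> l b = s"
      proof -
        have "h \<cdot> (l b \<cdot> f) = s \<cdot> f"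
          using homD[OF that(1)] homD[OF l(2)] homD[OF assms(2)] by (simp add: comp_ext[OF that(2)])
        then show ?thesis by (simp only: l(4))
      qed
      then show ?thesis using d by (auto simp: J_def k_def)
    qed
    with ex show "\<exists>!h. h \<in> hom C P Q \<and> h \<cdot> l b = s \<and> h \<cdot> l c = t" by simp
  qed
  then show ?thesis by (rule that)
qed

lemma ex_pullback:
  assumes "complete K C" "f \<in> hom C X Z" "g \<in> hom C Y Z"
  obtains p q where "is_pullback C f g p q"
proof -
  obtain a b c u v :: 'k where d: "distinct [a, b, c, u, v]" by (rule ex_five_distinct)
  \<comment> \<open>The cospan \<open>b \<rightarrow> a \<leftarrow> c\<close>, whose objects serve as their own identities.\<close>
  define J :: "('k, 'k) category" where
    "J = \<lparr>Obj = {a, b, c}, Arr = {a, b, c, u, v},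
      Dom = \<lambda>x. if x = u then b else if x = v then c else x,
      Cod = \<lambda>x. if x = u \<or> x = v then a else x, Ide = id,
      Comp = \<lambda>g f. if f = u \<or> f = v then f else g\<rparr>"
  define Fo where "Fo = (\<lambda>x. if x = a then Z else if x = b then X else Y)"
  define Fa where "Fa = (\<lambda>x. if x = u then f else if x = v then g else Ide C (Fo x))"
  have J: "category J" using d by unfold_locales (auto simp: J_def hom_def split: if_splits)
  have "is_functor J C Fo Fa"
    using d homD[OF assms(2)] homD[OF assms(3)]
    by (auto simp: is_functor_def J_def Fo_def Fa_def hom_def)
  moreover have "small J" by (rule finite_small) (simp add: J_def)
  ultimately obtain P l where P: "is_limit J C Fo Fa P l"
    using J assms unfolding complete_def by blast
  have l: "l a \<in> hom C P Z" "l b \<in> hom C P X" "l c \<in> hom C P Y" "f \<cdot> l b = l a" "g \<cdot> l c = l a"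
    using P d by (auto simp: is_limit_def is_cone_def J_def Fo_def Fa_def)
  have "is_pullback C f g (l b) (l c)"
    unfolding is_pullback_def
  proof (intro exI conjI allI ballI impI)
    show "f \<in> hom C X Z" "g \<in> hom C Y Z" "l b \<in> hom C P X" "l c \<in> hom C P Y" "f \<cdot> l b = g \<cdot> l c"
      using assms l by auto
    fix Q s t assume s: "s \<in> hom C Q X" and t: "t \<in> hom C Q Y" and st: "f \<cdot> s = g \<cdot> t"
    define k where "k = (\<lambda>x. if x = a then f \<cdot> s else if x = b then s else t)"
    have "is_cone J C Fo Fa Q k"
      using d s t homD[OF s] homD[OF t] homD[OF assms(2)] homD[OF assms(3)] st
        Comp_hom[OF s assms(2)] Comp_hom[OF t assms(3)]
      by (auto simp: is_cone_def J_def Fo_def Fa_def k_def)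
    then have ex: "\<exists>!h. h \<in> hom C Q P \<and> (\<forall>i \<in> Obj J. l i \<cdot> h = k i)"
      using P by (simp add: is_limit_def)
    have "(h \<in> hom C Q P \<and> (\<forall>i \<in> Obj J. l i \<cdot> h = k i)) \<longleftrightarrow>
        (h \<in> hom C Q P \<and> l b \<cdot> h = s \<and> l c \<cdot> h = t)" for h
    proof -
      have "l a \<cdot> h = f \<cdot> s" if "h \<in> hom C Q P" "l b \<cdot> h = s"
      proof -
        have "(f \<cdot> l b) \<cdot> h = f \<cdot> s"
          using homD[OF that(1)] homD[OF l(2)] homD[OF assms(2)] by (simp add: that(2))
        then show ?thesis by (simp only: l(4))
      qed
      then show ?thesis using d by (auto simp: J_def k_def)
    qed
    with ex show "\<exists>!h. h \<in> hom C Q P \<and> l b \<cdot> h = s \<and> l c \<cdot> h = t" by simp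
  qed
  then show ?thesis by (rule that)
qed

end

section \<open>Cofibrant and fibrant objects of a premodel category\<close>

locale premodel_structure = category M
  for M :: "('o, 'a, 'm) premodel_scheme" (structure) +
  fixes K :: "'k itself"
  assumes infinite_universe: "infinite (UNIV :: 'k set)"
    and premodel: "premodel_category K M"
begin

abbreviation "is_cofibrant X \<equiv> cofibrant M (Cof M) X"
abbreviation "is_fibrant X \<equiv> fibrant M (Fib M) X"

lemma Cof_wfs: "wfs M (Cof M) (AnFib M)" and AnCof_wfs: "wfs M (AnCof M) (Fib M)"
  and AnCof_Cof: "i \<in> AnCof M \<Longrightarrow> i \<in> Cof M" and complete: "complete K M" and cocomplete: "cocomplete K M"
  using premodel by (auto simp: premodel_category_def)

lemma AnFib_Fib: "p \<in> AnFib M \<Longrightarrow> p \<in> Fib M"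
  using wfs_rightI[OF AnCof_wfs] wfs_right_Arr[OF Cof_wfs] wfs_lifts[OF Cof_wfs] AnCof_Cof by blast

lemma initial_map: "is_initial M Z \<Longrightarrow> X \<in> Obj M \<Longrightarrow> \<exists>f. f \<in> hom M Z X"
  and initial_unique: "is_initial M Z \<Longrightarrow> f \<in> hom M Z X \<Longrightarrow> g \<in> hom M Z X \<Longrightarrow> f = g"
  using homD(5) unfolding is_initial_def by blast+

lemma terminal_map: "is_terminal M T \<Longrightarrow> X \<in> Obj M \<Longrightarrow> \<exists>f. f \<in> hom M X T"
  and terminal_unique: "is_terminal M T \<Longrightarrow> f \<in> hom M X T \<Longrightarrow> g \<in> hom M X T \<Longrightarrow> f = g"
  using homD(4) unfolding is_terminal_def by blast+

lemma cofibrantE: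
  assumes "is_cofibrant X"
  obtains Z z where "is_initial M Z" "z \<in> hom M Z X" "z \<in> Cof M"
  using assms unfolding cofibrant_def by blast

lemma cofibrantI: "is_initial M Z \<Longrightarrow> z \<in> hom M Z X \<Longrightarrow> z \<in> Cof M \<Longrightarrow> is_cofibrant X"
  unfolding cofibrant_def by blast

lemma fibrantE:
  assumes "is_fibrant X"
  obtains T t where "is_terminal M T" "t \<in> hom M X T" "t \<in> Fib M"
  using assms unfolding fibrant_def by blast

lemma fibrantI: "is_terminal M T \<Longrightarrow> t \<in> hom M X T \<Longrightarrow> t \<in> Fib M \<Longrightarrow> is_fibrant X"
  unfolding fibrant_def by blast

lemma cofibrant_Obj: "is_cofibrant X \<Longrightarrow> X \<in> Obj M"
  using homD(5) by (auto elim: cofibrantE)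

lemma cofibrant_Cod_Cof:
  assumes "is_cofibrant A" "i \<in> Cof M" "i \<in> hom M A B"
  shows "is_cofibrant B"
proof -
  obtain Z z where "is_initial M Z" "z \<in> hom M Z A" "z \<in> Cof M" using assms(1) by (rule cofibrantE)
  then show ?thesis
    using cofibrantI wfs_left_comp[OF Cof_wfs _ assms(2) _ assms(3)] Comp_hom[OF _ assms(3)] by blast
qed

lemma fibrant_Dom_Fib:
  assumes "is_fibrant Y" "p \<in> Fib M" "p \<in> hom M X Y"
  shows "is_fibrant X"
proof -
  obtain T t where "is_terminal M T" "t \<in> hom M Y T" "t \<in> Fib M" using assms(1) by (rule fibrantE)
  then show ?thesis
    using fibrantI wfs_right_comp[OF AnCof_wfs assms(2) _ assms(3)] Comp_hom[OF assms(3)] by blast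
qed

lemma terminal_fibrant: "is_terminal M T \<Longrightarrow> is_fibrant T"
  using fibrantI[of T "Ide M T" T] Ide_hom[of T] wfs_right_Ide[OF AnCof_wfs, of T]
  by (simp add: is_terminal_def)

lemma initial_cofibrant: "is_initial M Z \<Longrightarrow> is_cofibrant Z"
  using cofibrantI[of Z "Ide M Z" Z] Ide_hom[of Z] wfs_left_Ide[OF Cof_wfs, of Z]
  by (simp add: is_initial_def)

lemma cofibrant_lift:
  assumes "is_cofibrant A" "q \<in> AnFib M" "q \<in> hom M E Y" "f \<in> hom M A Y"
  obtains g where "g \<in> hom M A E" "q \<cdot> g = f"
proof -
  obtain Z z where Z: "is_initial M Z" "z \<in> hom M Z A" "z \<in> Cof M" using assms(1) by (rule cofibrantE)
  obtain u where u: "u \<in> hom M Z E" using initial_map[OF Z(1) homD(4)[OF assms(3)]] by blast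
  have "q \<cdot> u = f \<cdot> z"
    using initial_unique[OF Z(1) Comp_hom[OF u assms(3)] Comp_hom[OF Z(2) assms(4)]] .
  from liftsE[OF wfs_lifts[OF Cof_wfs Z(3) assms(2)] Z(2) assms(3) u assms(4) this] that
  show ?thesis by metis
qed

lemma fibrant_extension:
  assumes "is_fibrant X" "j \<in> AnCof M" "j \<in> hom M A B" "f \<in> hom M A X"
  obtains g where "g \<in> hom M B X" "g \<cdot> j = f"
proof -
  obtain T t where T: "is_terminal M T" "t \<in> hom M X T" "t \<in> Fib M" using assms(1) by (rule fibrantE)
  obtain v where v: "v \<in> hom M B T" using terminal_map[OF T(1) homD(5)[OF assms(3)]] by blast
  have "t \<cdot> f = v \<cdot> j"
    using terminal_unique[OF T(1) Comp_hom[OF assms(4) T(2)] Comp_hom[OF assms(3) v]] .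
  from liftsE[OF wfs_lifts[OF AnCof_wfs assms(2) T(3)] assms(3) T(2) assms(4) v this] that
  show ?thesis by metis
qed

lemma cofibrant_replacement:
  assumes "X \<in> Obj M"
  obtains X' a where "is_cofibrant X'" "a \<in> AnFib M" "a \<in> hom M X' X"
proof -
  obtain Z where Z: "is_initial M Z" using ex_initial[OF category_axioms infinite_universe cocomplete] .
  obtain f where "f \<in> hom M Z X" using initial_map[OF Z assms] by blast
  from wfs_factorE[OF Cof_wfs this] cofibrantI[OF Z] that show ?thesis by metis
qed

lemma fibrant_replacement:
  assumes "X \<in> Obj M"
  obtains X' j where "is_fibrant X'" "j \<in> AnCof M" "j \<in> hom M X X'"
proof -
  obtain T where T: "is_terminal M T" using ex_terminal[OF category_axioms infinite_universe complete] .
  obtain f where "f \<in> hom M X T" using terminal_map[OF T assms] by blast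
  from wfs_factorE[OF AnCof_wfs this] fibrantI[OF T] that show ?thesis by metis
qed

lemma AnFib_acyclic_fibration:
  assumes "q \<in> AnFib M"
  shows "acyclic_fibration M q"
  unfolding acyclic_fibration_def using AnFib_Fib[OF assms] wfs_lifts[OF Cof_wfs _ assms] by blast

lemma AnCof_acyclic_cofibration:
  assumes "i \<in> AnCof M"
  shows "acyclic_cofibration M i"
  unfolding acyclic_cofibration_def using AnCof_Cof[OF assms] wfs_lifts[OF AnCof_wfs assms] by blast

lemma acyclic_fibration_iff:
  "acyclic_fibration M p \<longleftrightarrow> p \<in> Fib M \<and> (\<forall>i \<in> Cof M. is_cofibrant (Dom M i) \<longrightarrow> lifts M i p)"
proof -
  have "is_cofibrant (Cod M i)" if "i \<in> Cof M" "is_cofibrant (Dom M i)" for i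
    using cofibrant_Cod_Cof[OF that(2,1) homI] wfs_left_Arr[OF Cof_wfs that(1)] by blast
  then show ?thesis unfolding acyclic_fibration_def by blast
qed

text \<open>A coproduct is a pushout over an initial object, so the absolute and the relative cylinders are
  instances of one notion.\<close>

lemma has_strong_cylinder_iff:
  assumes Z: "is_initial M Z" "z \<in> hom M Z X"
  shows "has_strong_cylinder M X \<longleftrightarrow> has_relative_strong_cylinder M z"
proof -
  have "is_coproduct M X X i j \<longleftrightarrow> is_pushout M z z i j" for i j
  proof
    assume "is_coproduct M X X i j"
    then obtain P where i: "i \<in> hom M X P" and j: "j \<in> hom M X P" and
      univ: "\<And>Q u v. u \<in> hom M X Q \<Longrightarrow> v \<in> hom M X Q \<Longrightarrow>
        (\<exists>!h. h \<in> hom M P Q \<and> h \<cdot> i = u \<and> h \<cdot> j = v)"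
      unfolding is_coproduct_def by blast
    show "is_pushout M z z i j"
      unfolding is_pushout_def
    proof (intro exI conjI allI ballI impI)
      show "i \<cdot> z = j \<cdot> z" using initial_unique[OF Z(1) Comp_hom[OF Z(2) i] Comp_hom[OF Z(2) j]] .
    qed (use Z i j univ in blast)+
  next
    assume "is_pushout M z z i j"
    then obtain X1 X2 Z' P where z: "z \<in> hom M Z' X1" "z \<in> hom M Z' X2" and
      i: "i \<in> hom M X1 P" and j: "j \<in> hom M X2 P" and
      univ: "\<And>Q u v. u \<in> hom M X1 Q \<Longrightarrow> v \<in> hom M X2 Q \<Longrightarrow> u \<cdot> z = v \<cdot> z \<Longrightarrow>
        (\<exists>!h. h \<in> hom M P Q \<and> h \<cdot> i = u \<and> h \<cdot> j = v)"
      unfolding is_pushout_def by blast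
    have [simp]: "X1 = X" "X2 = X" using z Z(2) by (auto simp: hom_def)
    show "is_coproduct M X X i j"
      unfolding is_coproduct_def
    proof (intro exI conjI allI ballI)
      show "i \<in> hom M X P" "j \<in> hom M X P" using i j by auto
      fix Q u v assume uv: "u \<in> hom M X Q" "v \<in> hom M X Q"
      have "u \<cdot> z = v \<cdot> z"
        using initial_unique[OF Z(1) Comp_hom[OF Z(2) uv(1)] Comp_hom[OF Z(2) uv(2)]] .
      then show "\<exists>!h. h \<in> hom M P Q \<and> h \<cdot> i = u \<and> h \<cdot> j = v" using univ uv by simp
    qed
  qed
  then show ?thesis
    unfolding has_strong_cylinder_def has_relative_strong_cylinder_def homD(3)[OF Z(2)] by simp
qed

text \<open>In a semi-model structure exactly the equivalences are resolved in this way. The condition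
  mentions only the two factorization systems, which is why they determine the equivalences.\<close>

definition anodyne_resolution :: "'a \<Rightarrow> bool" where
  "anodyne_resolution f \<longleftrightarrow> (\<exists>X' Y' a i b. is_cofibrant X' \<and>
     a \<in> AnFib M \<and> a \<in> hom M X' (Dom M f) \<and> i \<in> AnCof M \<and> i \<in> hom M X' Y' \<and>
     b \<in> AnFib M \<and> b \<in> hom M Y' (Cod M f) \<and> f \<cdot> a = b \<cdot> i)"

end


section \<open>From a semi-model structure to cylinders, paths and saturation\<close>

locale fresse_structure = premodel_structure M K
  for M :: "('o, 'a, 'm) premodel_scheme" (structure) and K :: "'k itself" +
  fixes W :: "'a set"
  assumes fresse: "fresse_left_semi_model K M W (Cof M) (Fib M)"
begin

lemma W_Arr: "f \<in> W \<Longrightarrow> f \<in> Arr M"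
  using fresse unfolding fresse_left_semi_model_def by blast

lemma W_two_out_of_three:
  assumes "f \<in> hom M X Y" "g \<in> hom M Y Z"
  shows "f \<in> W \<Longrightarrow> g \<in> W \<Longrightarrow> g \<cdot> f \<in> W" "f \<in> W \<Longrightarrow> g \<cdot> f \<in> W \<Longrightarrow> g \<in> W"
    "g \<in> W \<Longrightarrow> g \<cdot> f \<in> W \<Longrightarrow> f \<in> W"
proof -
  have "Cod M f = Dom M g" using homD(3)[OF assms(1)] homD(2)[OF assms(2)] by simp
  moreover have "two_out_of_three M W" using fresse unfolding fresse_left_semi_model_def by blast
  note this[unfolded two_out_of_three_def, THEN bspec, OF homD(1)[OF assms(1)],
      THEN bspec, OF homD(1)[OF assms(2)], THEN mp]
  ultimately have "(f \<in> W \<and> g \<in> W \<longrightarrow> g \<cdot> f \<in> W) \<and> (f \<in> W \<and> g \<cdot> f \<in> W \<longrightarrow> g \<in> W) \<and>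
      (g \<in> W \<and> g \<cdot> f \<in> W \<longrightarrow> f \<in> W)" by blast
  then show "f \<in> W \<Longrightarrow> g \<in> W \<Longrightarrow> g \<cdot> f \<in> W" "f \<in> W \<Longrightarrow> g \<cdot> f \<in> W \<Longrightarrow> g \<in> W"
    "g \<in> W \<Longrightarrow> g \<cdot> f \<in> W \<Longrightarrow> f \<in> W" by blast+
qed

lemma W_comp: "f \<in> W \<Longrightarrow> g \<in> W \<Longrightarrow> f \<in> hom M X Y \<Longrightarrow> g \<in> hom M Y Z \<Longrightarrow> g \<cdot> f \<in> W"
  and W_cancel_right: "f \<in> W \<Longrightarrow> g \<cdot> f \<in> W \<Longrightarrow> f \<in> hom M X Y \<Longrightarrow> g \<in> hom M Y Z \<Longrightarrow> g \<in> W"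
  and W_cancel_left: "g \<in> W \<Longrightarrow> g \<cdot> f \<in> W \<Longrightarrow> f \<in> hom M X Y \<Longrightarrow> g \<in> hom M Y Z \<Longrightarrow> f \<in> W"
  using W_two_out_of_three by blast+

lemma W_retract: "retract_of M f g \<Longrightarrow> g \<in> W \<Longrightarrow> f \<in> W"
  using fresse unfolding fresse_left_semi_model_def retract_stable_def by blast

lemma Fresse_lifts:
  "i \<in> Cof M \<Longrightarrow> p \<in> Fib M \<Longrightarrow> is_cofibrant (Dom M i) \<Longrightarrow> i \<in> W \<or> p \<in> W \<Longrightarrow> lifts M i p"
  using fresse unfolding fresse_left_semi_model_def by simp

lemma Fresse_factors:
  "f \<in> Arr M \<Longrightarrow> is_cofibrant (Dom M f) \<Longrightarrow> factors_as M (Cof M) (Fib M \<inter> W) f"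
  "f \<in> Arr M \<Longrightarrow> is_cofibrant (Dom M f) \<Longrightarrow> factors_as M (Cof M \<inter> W) (Fib M) f"
  using fresse unfolding fresse_left_semi_model_def by simp_all

lemma Fresse_factor_Cof:
  assumes "f \<in> hom M X Y" "is_cofibrant X"
  obtains E l r where "l \<in> Cof M" "r \<in> Fib M" "r \<in> W" "l \<in> hom M X E" "r \<in> hom M E Y" "f = r \<cdot> l"
proof -
  obtain l r where *: "l \<in> Cof M" "r \<in> Fib M" "r \<in> W" "l \<in> Arr M" "r \<in> Arr M" "Cod M l = Dom M r"
    "f = r \<cdot> l"
    using Fresse_factors(1)[of f] homD[OF assms(1)] assms(2) unfolding factors_as_def by auto
  have "l \<in> hom M X (Dom M r)" "r \<in> hom M (Dom M r) Y"
    using homD[OF assms(1)] * by (auto intro!: homI)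
  with * that show ?thesis by blast
qed

lemma Fresse_factor_Fib:
  assumes "f \<in> hom M X Y" "is_cofibrant X"
  obtains E l r where "l \<in> Cof M" "l \<in> W" "r \<in> Fib M" "l \<in> hom M X E" "r \<in> hom M E Y" "f = r \<cdot> l"
proof -
  obtain l r where *: "l \<in> Cof M" "l \<in> W" "r \<in> Fib M" "l \<in> Arr M" "r \<in> Arr M" "Cod M l = Dom M r"
    "f = r \<cdot> l"
    using Fresse_factors(2)[of f] homD[OF assms(1)] assms(2) unfolding factors_as_def by auto
  have "l \<in> hom M X (Dom M r)" "r \<in> hom M (Dom M r) Y"
    using homD[OF assms(1)] * by (auto intro!: homI)
  with * that show ?thesis by blast
qed

text \<open>The retract argument for the factorization into a trivial cofibration and a fibration.\<close>

lemma core_AnCof_W: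
  assumes "i \<in> AnCof M" "i \<in> hom M A B" "is_cofibrant A"
  shows "i \<in> W"
proof -
  obtain E l r where *: "l \<in> Cof M" "l \<in> W" "r \<in> Fib M" "l \<in> hom M A E" "r \<in> hom M E B" "i = r \<cdot> l"
    using Fresse_factor_Fib[OF assms(2,3)] .
  have "retract_of M i l"
    using retract_argument_left[OF *(4-6)] wfs_lifts[OF AnCof_wfs assms(1) *(3)] by blast
  then show ?thesis using W_retract *(2) by blast
qed

lemma core_Cof_W_AnCof:
  assumes "i \<in> Cof M" "i \<in> W" "i \<in> hom M A B" "is_cofibrant A"
  shows "i \<in> AnCof M"
  using Fresse_lifts[OF assms(1)] assms homD[OF assms(3)] by (intro wfs_leftI[OF AnCof_wfs]) auto

text \<open>The factorizations of the structure only apply to maps with cofibrant domain. Precomposing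
  with a trivial fibration from a cofibrant object reduces to that case, where the retract
  argument applies.\<close>

lemma acyclic_fibration_W:
  assumes "acyclic_fibration M q"
  shows "q \<in> W"
proof -
  have q: "q \<in> hom M (Dom M q) (Cod M q)"
    using assms wfs_right_Arr[OF AnCof_wfs] by (auto simp: acyclic_fibration_def intro: homI)
  obtain Z where Z: "is_initial M Z" using ex_initial[OF category_axioms infinite_universe cocomplete] .
  obtain z where z: "z \<in> hom M Z (Dom M q)" using initial_map[OF Z homD(4)[OF q]] by blast
  obtain X' l a where a: "l \<in> Cof M" "a \<in> Fib M" "a \<in> W" "l \<in> hom M Z X'" "a \<in> hom M X' (Dom M q)"
    using Fresse_factor_Cof[OF z initial_cofibrant[OF Z]] .
  have X': "is_cofibrant X'" using cofibrantI[OF Z a(4,1)] .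
  have qa: "q \<cdot> a \<in> hom M X' (Cod M q)" using Comp_hom[OF a(5) q] .
  obtain E c b where b: "c \<in> Cof M" "b \<in> Fib M" "b \<in> W" "c \<in> hom M X' E" "b \<in> hom M E (Cod M q)"
      "q \<cdot> a = b \<cdot> c"
    using Fresse_factor_Cof[OF qa X'] .
  have c: "c \<in> Arr M" "is_cofibrant (Dom M c)" using homD[OF b(4)] X' by auto
  have "lifts M c a" using Fresse_lifts[OF b(1) a(2) c(2)] a(3) by blast
  moreover have "lifts M c q" using assms b(1) c by (simp add: acyclic_fibration_iff)
  ultimately have "lifts M c (q \<cdot> a)" using lifts_comp_right[OF _ _ a(5) q c(1)] by blast
  then have "q \<cdot> a \<in> W" using retract_argument_right[OF b(4-6)] W_retract b(3) by blast
  then show ?thesis using W_cancel_right[OF a(3) _ a(5) q] by blast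
qed

lemma AnFib_W: "q \<in> AnFib M \<Longrightarrow> q \<in> W"
  using acyclic_fibration_W AnFib_acyclic_fibration by blast

lemma Ide_W: "X \<in> Obj M \<Longrightarrow> Ide M X \<in> W"
  using AnFib_W wfs_right_Ide[OF Cof_wfs] by blast

lemma acyclic_fibration_iff_W: "acyclic_fibration M p \<longleftrightarrow> p \<in> Fib M \<and> p \<in> W"
  using acyclic_fibration_W Fresse_lifts by (auto simp: acyclic_fibration_iff)

lemma W_iff: "f \<in> W \<longleftrightarrow> f \<in> Arr M \<and> anodyne_resolution f"
proof (intro iffI conjI)
  assume f: "f \<in> W"
  then show "f \<in> Arr M" by (rule W_Arr)
  then have fh: "f \<in> hom M (Dom M f) (Cod M f)" by (auto intro: homI)
  obtain X' a where a: "is_cofibrant X'" "a \<in> AnFib M" "a \<in> hom M X' (Dom M f)"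
    using cofibrant_replacement[OF homD(4)[OF fh]] .
  have fa: "f \<cdot> a \<in> hom M X' (Cod M f)" using Comp_hom[OF a(3) fh] .
  obtain Y' i b where b: "i \<in> Cof M" "b \<in> AnFib M" "i \<in> hom M X' Y'" "b \<in> hom M Y' (Cod M f)"
    "f \<cdot> a = b \<cdot> i"
    using wfs_factorE[OF Cof_wfs fa] .
  have "b \<cdot> i \<in> W" using W_comp[OF AnFib_W[OF a(2)] f a(3) fh] b(5) by simp
  then have "i \<in> W" using W_cancel_left[OF AnFib_W[OF b(2)] _ b(3,4)] by blast
  then have "i \<in> AnCof M" using core_Cof_W_AnCof[OF b(1) _ b(3) a(1)] by blast
  with a b show "anodyne_resolution f" unfolding anodyne_resolution_def by blast
next
  assume "f \<in> Arr M \<and> anodyne_resolution f"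
  then obtain X' Y' a i b where f: "f \<in> Arr M" and a: "is_cofibrant X'" "a \<in> AnFib M"
    "a \<in> hom M X' (Dom M f)" and i: "i \<in> AnCof M" "i \<in> hom M X' Y'" and
    b: "b \<in> AnFib M" "b \<in> hom M Y' (Cod M f)" "f \<cdot> a = b \<cdot> i"
    unfolding anodyne_resolution_def by blast
  have fh: "f \<in> hom M (Dom M f) (Cod M f)" using f by (auto intro: homI)
  have "f \<cdot> a \<in> W" using W_comp[OF core_AnCof_W[OF i a(1)] AnFib_W[OF b(1)] i(2) b(2)] b(3) by simp
  then show "f \<in> W" using W_cancel_right[OF AnFib_W[OF a(2)] _ a(3) fh] by blast
qed

text \<open>Factor the codiagonal as a cofibration followed by an anodyne fibration \<open>r\<close>. The first inclusion
  into the cylinder is an equivalence because it is a section of the equivalence \<open>r\<close>.\<close>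

lemma core_Cof_has_relative_strong_cylinder:
  assumes "f \<in> Cof M" "f \<in> hom M A X" "is_cofibrant A"
  shows "has_relative_strong_cylinder M f"
proof -
  have X: "is_cofibrant X" using cofibrant_Cod_Cof[OF assms(3,1,2)] .
  have IX: "Ide M X \<in> hom M X X" using cofibrant_Obj[OF X] by (rule Ide_hom)
  obtain i\<^sub>0 i\<^sub>1 where po: "is_pushout M f f i\<^sub>0 i\<^sub>1"
    using ex_pushout[OF category_axioms infinite_universe cocomplete assms(2,2)] .
  obtain X1 X2 A' P where i: "f \<in> hom M A' X1" "f \<in> hom M A' X2" "i\<^sub>0 \<in> hom M X1 P" "i\<^sub>1 \<in> hom M X2 P"
    and ex: "\<And>Q u v. u \<in> hom M X1 Q \<Longrightarrow> v \<in> hom M X2 Q \<Longrightarrow> u \<cdot> f = v \<cdot> f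
      \<Longrightarrow> \<exists>h \<in> hom M P Q. h \<cdot> i\<^sub>0 = u \<and> h \<cdot> i\<^sub>1 = v"
    using pushoutE[OF po] by metis
  have [simp]: "X1 = X" "X2 = X" using i(1,2) assms(2) by (auto simp: hom_def)
  obtain n where n: "n \<in> hom M P X" "n \<cdot> i\<^sub>0 = Ide M X" "n \<cdot> i\<^sub>1 = Ide M X"
    using ex[of "Ide M X" X "Ide M X"] IX by auto
  obtain I j r where j: "j \<in> Cof M" "r \<in> AnFib M" "j \<in> hom M P I" "r \<in> hom M I X" "n = r \<cdot> j"
    using wfs_factorE[OF Cof_wfs n(1)] .
  have i0: "i\<^sub>0 \<in> hom M X P" using i(3) by simp
  have ji: "j \<cdot> i\<^sub>0 \<in> hom M X I" using Comp_hom[OF i0 j(3)] .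
  have "(r \<cdot> j) \<cdot> i\<^sub>0 \<in> W" using Ide_W[OF cofibrant_Obj[OF X]] n(2) j(5) by simp
  then have "r \<cdot> (j \<cdot> i\<^sub>0) \<in> W" using homD[OF i0] homD[OF j(3)] homD[OF j(4)] by simp
  then have "j \<cdot> i\<^sub>0 \<in> W" using W_cancel_left[OF AnFib_W[OF j(2)] _ ji j(4)] by blast
  moreover have "j \<cdot> i\<^sub>0 \<in> Cof M"
    using wfs_left_comp[OF Cof_wfs wfs_left_pushout[OF Cof_wfs po assms(1)] j(1) i0 j(3)] .
  ultimately have "acyclic_cofibration M (j \<cdot> i\<^sub>0)"
    using AnCof_acyclic_cofibration core_Cof_W_AnCof[OF _ _ ji X] by blast
  moreover have "j \<in> hom M (Cod M i\<^sub>0) I" "r \<in> hom M I (Cod M f)"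
    using j(3,4) homD(3)[OF assms(2)] homD(3)[OF i0] by simp_all
  ultimately show ?thesis
    unfolding has_relative_strong_cylinder_def
    using po j(1) n(2,3)[unfolded j(5)] homD(3)[OF assms(2)] by metis
qed

text \<open>Dually, the first projection of the path object is a retraction of an anodyne cofibration \<open>s\<close>,
  which is an equivalence because its domain is cofibrant.\<close>

lemma Fib_has_relative_strong_path:
  assumes "f \<in> Fib M" "f \<in> hom M A X" "is_cofibrant A"
  shows "has_relative_strong_path M f"
proof -
  have IA: "Ide M A \<in> hom M A A" using cofibrant_Obj[OF assms(3)] by (rule Ide_hom)
  obtain p\<^sub>0 p\<^sub>1 where pb: "is_pullback M f f p\<^sub>0 p\<^sub>1"
    using ex_pullback[OF category_axioms infinite_universe complete assms(2,2)] .
  obtain A1 A2 X' Q where i: "f \<in> hom M A1 X'" "f \<in> hom M A2 X'" "p\<^sub>0 \<in> hom M Q A1" "p\<^sub>1 \<in> hom M Q A2"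
    and ex: "\<And>B u v. u \<in> hom M B A1 \<Longrightarrow> v \<in> hom M B A2 \<Longrightarrow> f \<cdot> u = f \<cdot> v
      \<Longrightarrow> \<exists>h \<in> hom M B Q. p\<^sub>0 \<cdot> h = u \<and> p\<^sub>1 \<cdot> h = v"
    using pullbackE[OF pb] by metis
  have [simp]: "A1 = A" "A2 = A" using i(1,2) assms(2) by (auto simp: hom_def)
  obtain n where n: "n \<in> hom M A Q" "p\<^sub>0 \<cdot> n = Ide M A" "p\<^sub>1 \<cdot> n = Ide M A"
    using ex[of "Ide M A" A "Ide M A"] IA by auto
  obtain P s q where s: "s \<in> AnCof M" "q \<in> Fib M" "s \<in> hom M A P" "q \<in> hom M P Q" "n = q \<cdot> s"
    using wfs_factorE[OF AnCof_wfs n(1)] .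
  have p0: "p\<^sub>0 \<in> hom M Q A" using i(3) by simp
  have pq: "p\<^sub>0 \<cdot> q \<in> hom M P A" using Comp_hom[OF s(4) p0] .
  have "p\<^sub>0 \<cdot> (q \<cdot> s) \<in> W" using Ide_W[OF cofibrant_Obj[OF assms(3)]] n(2) s(5) by simp
  then have "(p\<^sub>0 \<cdot> q) \<cdot> s \<in> W" using homD[OF p0] homD[OF s(3)] homD[OF s(4)] by simp
  then have "p\<^sub>0 \<cdot> q \<in> W" using W_cancel_right[OF core_AnCof_W[OF s(1,3) assms(3)] _ s(3) pq] by blast
  moreover have "p\<^sub>0 \<cdot> q \<in> Fib M"
    using wfs_right_comp[OF AnCof_wfs s(2) wfs_right_pullback[OF AnCof_wfs is_pullback_sym[OF pb] assms(1)]
        s(4) p0] .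
  ultimately have "acyclic_fibration M (p\<^sub>0 \<cdot> q)" by (simp add: acyclic_fibration_iff_W)
  moreover have "s \<in> hom M (Dom M f) P" "q \<in> hom M P (Dom M p\<^sub>0)"
    using s(3,4) homD(2)[OF assms(2)] homD(2)[OF p0] by simp_all
  ultimately show ?thesis
    unfolding has_relative_strong_path_def
    using pb s(2) n(2,3)[unfolded s(5)] homD(2)[OF assms(2)] by metis
qed

text \<open>An acyclic cofibration \<open>i\<close> composes with an anodyne cofibration to a fibrant object to one
  with fibrant target. There the lifting property against fibrations between fibrant objects
  suffices for the retract argument, and \<open>i\<close> is an equivalence by 2-out-of-3.\<close>

lemma core_left_saturated: "core_left_saturated M"
  unfolding core_left_saturated_def
proof (intro allI impI)
  fix i assume "acyclic_cofibration M i \<and> is_cofibrant (Dom M i)"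
  then have i: "i \<in> Cof M" and A: "is_cofibrant (Dom M i)" and acyclic:
    "\<And>p. p \<in> Fib M \<Longrightarrow> is_fibrant (Dom M p) \<Longrightarrow> is_fibrant (Cod M p) \<Longrightarrow> lifts M i p"
    unfolding acyclic_cofibration_def by blast+
  have ih: "i \<in> hom M (Dom M i) (Cod M i)" using wfs_left_Arr[OF Cof_wfs i] by (auto intro: homI)
  obtain B j where j: "is_fibrant B" "j \<in> AnCof M" "j \<in> hom M (Cod M i) B"
    using fibrant_replacement[OF homD(5)[OF ih]] .
  have ji: "j \<cdot> i \<in> hom M (Dom M i) B" using Comp_hom[OF ih j(3)] .
  obtain E l r where lr: "l \<in> AnCof M" "r \<in> Fib M" "l \<in> hom M (Dom M i) E" "r \<in> hom M E B" "j \<cdot> i = r \<cdot> l"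
    using wfs_factorE[OF AnCof_wfs ji] .
  have r: "r \<in> Arr M" "Cod M r = B" "Dom M r = E" using homD[OF lr(4)] by auto
  have "is_fibrant E" using fibrant_Dom_Fib[OF j(1) lr(2,4)] .
  then have "lifts M i r" using acyclic[OF lr(2)] j(1) r by simp
  then have "lifts M (j \<cdot> i) r"
    using lifts_comp_left[OF _ wfs_lifts[OF AnCof_wfs j(2) lr(2)] ih j(3) r(1)] by blast
  then have "retract_of M (j \<cdot> i) l" using retract_argument_left[OF lr(3-5)] by blast
  then have "j \<cdot> i \<in> AnCof M" using wfs_left_retract[OF AnCof_wfs _ lr(1)] by blast
  then have "j \<cdot> i \<in> W" using core_AnCof_W[OF _ ji A] by blast
  then have "i \<in> W"
    using W_cancel_left[OF core_AnCof_W[OF j(2,3) cofibrant_Cod_Cof[OF A i ih]] _ ih j(3)] by blast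
  then show "i \<in> AnCof M" using core_Cof_W_AnCof[OF i _ ih A] by blast
qed

lemma weak_model_category: "weak_model_category K M"
proof -
  have "f \<in> hom M (Dom M f) (Cod M f)" if "f \<in> Cof M \<or> f \<in> Fib M" for f
    using that wfs_left_Arr[OF Cof_wfs] wfs_right_Arr[OF AnCof_wfs] by (auto intro: homI)
  then show ?thesis
    unfolding weak_model_category_def
    using premodel core_Cof_has_relative_strong_cylinder Fib_has_relative_strong_path by blast
qed

lemma cofibrant_has_strong_cylinder:
  assumes "is_cofibrant X"
  shows "has_strong_cylinder M X"
proof -
  obtain Z z where "is_initial M Z" "z \<in> hom M Z X" "z \<in> Cof M" using assms by (rule cofibrantE)
  then show ?thesis
    using has_strong_cylinder_iff core_Cof_has_relative_strong_cylinder initial_cofibrant by blast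
qed

text \<open>A factorization system is determined by its left class, and the trivial fibrations are the
  acyclic fibrations.\<close>

lemma spitzweck_iff_right_saturated:
  "spitzweck_left_semi_model K M W (Cof M) (Fib M) \<longleftrightarrow> right_saturated M"
proof -
  have "spitzweck_left_semi_model K M W (Cof M) (Fib M) \<longleftrightarrow> Fib M \<inter> W = AnFib M"
  proof
    assume "spitzweck_left_semi_model K M W (Cof M) (Fib M)"
    then have "wfs M (Cof M) (Fib M \<inter> W)" by (simp add: spitzweck_left_semi_model_def)
    then show "Fib M \<inter> W = AnFib M"
      using wfs_right_iff Cof_wfs by blast
  qed (use fresse Cof_wfs in \<open>simp add: spitzweck_left_semi_model_def\<close>)
  also have "\<dots> \<longleftrightarrow> right_saturated M"
    using AnFib_Fib AnFib_W by (auto simp: right_saturated_def acyclic_fibration_iff_W)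
  finally show ?thesis .
qed

end

section \<open>Homotopy of maps from cofibrant to bifibrant objects\<close>

locale cylindrical_structure = premodel_structure M K
  for M :: "('o, 'a, 'm) premodel_scheme" (structure) and K :: "'k itself" +
  assumes weak_model: "weak_model_category K M"
    and strong_cylinder: "is_cofibrant X \<Longrightarrow> has_strong_cylinder M X"
    and saturated: "core_left_saturated M"
begin

abbreviation "is_bifibrant X \<equiv> is_cofibrant X \<and> is_fibrant X"

text \<open>The last clause says that the pair of \<open>e\<^sub>0\<close> and \<open>e\<^sub>1\<close>, as a map out of the pushout of
  \<open>f\<close> along itself, lifts against acyclic fibrations. The cylinders of an object are those of
  the map to it from an initial object.\<close>

definition cylinder :: "'a \<Rightarrow> 'o \<Rightarrow> 'o \<Rightarrow> 'a \<Rightarrow> 'a \<Rightarrow> 'a \<Rightarrow> bool" where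
  "cylinder f X I e\<^sub>0 e\<^sub>1 r \<longleftrightarrow>
     e\<^sub>0 \<in> hom M X I \<and> e\<^sub>1 \<in> hom M X I \<and> r \<in> hom M I X \<and>
     e\<^sub>0 \<cdot> f = e\<^sub>1 \<cdot> f \<and> r \<cdot> e\<^sub>0 = Ide M X \<and> r \<cdot> e\<^sub>1 = Ide M X \<and> e\<^sub>0 \<in> AnCof M \<and>
     (\<forall>q E Y u\<^sub>0 u\<^sub>1 v. acyclic_fibration M q \<longrightarrow> q \<in> hom M E Y \<longrightarrow>
        u\<^sub>0 \<in> hom M X E \<longrightarrow> u\<^sub>1 \<in> hom M X E \<longrightarrow> v \<in> hom M I Y \<longrightarrow>
        u\<^sub>0 \<cdot> f = u\<^sub>1 \<cdot> f \<longrightarrow> q \<cdot> u\<^sub>0 = v \<cdot> e\<^sub>0 \<longrightarrow> q \<cdot> u\<^sub>1 = v \<cdot> e\<^sub>1 \<longrightarrow>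
        (\<exists>h \<in> hom M I E. h \<cdot> e\<^sub>0 = u\<^sub>0 \<and> h \<cdot> e\<^sub>1 = u\<^sub>1 \<and> q \<cdot> h = v))"

text \<open>Dually, the last clause says that the pair of \<open>d\<^sub>0\<close> and \<open>d\<^sub>1\<close>, as a map to the product of
  two copies of \<open>X\<close>, is a fibration.\<close>

definition path_object :: "'o \<Rightarrow> 'o \<Rightarrow> 'a \<Rightarrow> 'a \<Rightarrow> 'a \<Rightarrow> bool" where
  "path_object X P s d\<^sub>0 d\<^sub>1 \<longleftrightarrow>
     s \<in> hom M X P \<and> d\<^sub>0 \<in> hom M P X \<and> d\<^sub>1 \<in> hom M P X \<and>
     d\<^sub>0 \<cdot> s = Ide M X \<and> d\<^sub>1 \<cdot> s = Ide M X \<and> acyclic_fibration M d\<^sub>0 \<and>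
     (\<forall>j A B a b\<^sub>0 b\<^sub>1. j \<in> AnCof M \<longrightarrow> j \<in> hom M A B \<longrightarrow>
        a \<in> hom M A P \<longrightarrow> b\<^sub>0 \<in> hom M B X \<longrightarrow> b\<^sub>1 \<in> hom M B X \<longrightarrow>
        d\<^sub>0 \<cdot> a = b\<^sub>0 \<cdot> j \<longrightarrow> d\<^sub>1 \<cdot> a = b\<^sub>1 \<cdot> j \<longrightarrow>
        (\<exists>h \<in> hom M B P. h \<cdot> j = a \<and> d\<^sub>0 \<cdot> h = b\<^sub>0 \<and> d\<^sub>1 \<cdot> h = b\<^sub>1))"

lemma cylinderD:
  assumes "cylinder f X I e\<^sub>0 e\<^sub>1 r"
  shows "e\<^sub>0 \<in> hom M X I" "e\<^sub>1 \<in> hom M X I" "r \<in> hom M I X" "e\<^sub>0 \<cdot> f = e\<^sub>1 \<cdot> f"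
    "r \<cdot> e\<^sub>0 = Ide M X" "r \<cdot> e\<^sub>1 = Ide M X" "e\<^sub>0 \<in> AnCof M"
  using assms unfolding cylinder_def by blast+

lemma cylinder_lift:
  assumes "cylinder f X I e\<^sub>0 e\<^sub>1 r" "acyclic_fibration M q" "q \<in> hom M E Y"
    "u\<^sub>0 \<in> hom M X E" "u\<^sub>1 \<in> hom M X E" "v \<in> hom M I Y"
    "u\<^sub>0 \<cdot> f = u\<^sub>1 \<cdot> f" "q \<cdot> u\<^sub>0 = v \<cdot> e\<^sub>0" "q \<cdot> u\<^sub>1 = v \<cdot> e\<^sub>1"
  obtains h where "h \<in> hom M I E" "h \<cdot> e\<^sub>0 = u\<^sub>0" "h \<cdot> e\<^sub>1 = u\<^sub>1" "q \<cdot> h = v"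
  using assms unfolding cylinder_def by blast

lemma path_objectD:
  assumes "path_object X P s d\<^sub>0 d\<^sub>1"
  shows "s \<in> hom M X P" "d\<^sub>0 \<in> hom M P X" "d\<^sub>1 \<in> hom M P X" "d\<^sub>0 \<cdot> s = Ide M X" "d\<^sub>1 \<cdot> s = Ide M X"
    "acyclic_fibration M d\<^sub>0"
  using assms unfolding path_object_def by blast+

lemma path_object_lift:
  assumes "path_object X P s d\<^sub>0 d\<^sub>1" "j \<in> AnCof M" "j \<in> hom M A B"
    "a \<in> hom M A P" "b\<^sub>0 \<in> hom M B X" "b\<^sub>1 \<in> hom M B X" "d\<^sub>0 \<cdot> a = b\<^sub>0 \<cdot> j" "d\<^sub>1 \<cdot> a = b\<^sub>1 \<cdot> j"
  obtains h where "h \<in> hom M B P" "h \<cdot> j = a" "d\<^sub>0 \<cdot> h = b\<^sub>0" "d\<^sub>1 \<cdot> h = b\<^sub>1"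
  using assms unfolding path_object_def by blast

lemma cylinder_exists:
  assumes "f \<in> Cof M" "f \<in> hom M A X" "is_cofibrant A" "has_relative_strong_cylinder M f"
  shows "\<exists>I e\<^sub>0 e\<^sub>1 r. cylinder f X I e\<^sub>0 e\<^sub>1 r"
proof -
  have X: "is_cofibrant X" using cofibrant_Cod_Cof[OF assms(3,1,2)] .
  obtain i\<^sub>0 i\<^sub>1 I j r where po: "is_pushout M f f i\<^sub>0 i\<^sub>1" and
    j0: "j \<in> hom M (Cod M i\<^sub>0) I" and r: "r \<in> hom M I X" and
    eq: "(r \<cdot> j) \<cdot> i\<^sub>0 = Ide M X" "(r \<cdot> j) \<cdot> i\<^sub>1 = Ide M X" and
    jC: "j \<in> Cof M" and ac: "acyclic_cofibration M (j \<cdot> i\<^sub>0)"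
    using assms(4) unfolding has_relative_strong_cylinder_def homD(3)[OF assms(2)] by blast
  obtain X1 X2 A' P where i: "f \<in> hom M A' X1" "f \<in> hom M A' X2" "i\<^sub>0 \<in> hom M X1 P" "i\<^sub>1 \<in> hom M X2 P"
    "i\<^sub>0 \<cdot> f = i\<^sub>1 \<cdot> f"
    and ex: "\<And>Q u v. u \<in> hom M X1 Q \<Longrightarrow> v \<in> hom M X2 Q \<Longrightarrow> u \<cdot> f = v \<cdot> f
      \<Longrightarrow> \<exists>h \<in> hom M P Q. h \<cdot> i\<^sub>0 = u \<and> h \<cdot> i\<^sub>1 = v"
    and uniq: "\<And>Q x y. x \<in> hom M P Q \<Longrightarrow> y \<in> hom M P Q \<Longrightarrow> x \<cdot> i\<^sub>0 = y \<cdot> i\<^sub>0 \<Longrightarrow> x \<cdot> i\<^sub>1 = y \<cdot> i\<^sub>1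
      \<Longrightarrow> x = y"
    using pushoutE[OF po] by metis
  have [simp]: "X1 = X" "X2 = X" "A' = A" using i(1,2) assms(2) by (auto simp: hom_def)
  have i0: "i\<^sub>0 \<in> hom M X P" and i1: "i\<^sub>1 \<in> hom M X P" using i(3,4) by auto
  have j: "j \<in> hom M P I" using j0 homD(3)[OF i0] by simp
  note h = homD[OF i0] homD[OF i1] homD[OF j] homD[OF r] homD[OF assms(2)]
  have "i\<^sub>0 \<in> Cof M" using wfs_left_pushout[OF Cof_wfs po assms(1)] .
  then have P: "is_cofibrant P" using cofibrant_Cod_Cof[OF X _ i0] by blast
  have "is_cofibrant (Dom M (j \<cdot> i\<^sub>0))" using X h by simp
  then have an: "j \<cdot> i\<^sub>0 \<in> AnCof M" using saturated ac unfolding core_left_saturated_def by blast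
  have "\<exists>k \<in> hom M I E. k \<cdot> (j \<cdot> i\<^sub>0) = u\<^sub>0 \<and> k \<cdot> (j \<cdot> i\<^sub>1) = u\<^sub>1 \<and> q \<cdot> k = v"
    if q: "acyclic_fibration M q" "q \<in> hom M E Y" and u: "u\<^sub>0 \<in> hom M X E" "u\<^sub>1 \<in> hom M X E"
      and v: "v \<in> hom M I Y" and e: "u\<^sub>0 \<cdot> f = u\<^sub>1 \<cdot> f" "q \<cdot> u\<^sub>0 = v \<cdot> (j \<cdot> i\<^sub>0)" "q \<cdot> u\<^sub>1 = v \<cdot> (j \<cdot> i\<^sub>1)"
    for q E Y u\<^sub>0 u\<^sub>1 v
  proof -
    obtain u where uh: "u \<in> hom M P E" and ui: "u \<cdot> i\<^sub>0 = u\<^sub>0" "u \<cdot> i\<^sub>1 = u\<^sub>1"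
      using ex[of u\<^sub>0 E u\<^sub>1] u e(1) by auto
    have "(q \<cdot> u) \<cdot> i\<^sub>0 = (v \<cdot> j) \<cdot> i\<^sub>0" "(q \<cdot> u) \<cdot> i\<^sub>1 = (v \<cdot> j) \<cdot> i\<^sub>1"
      using h homD[OF q(2)] homD[OF uh] homD[OF v] by (simp_all add: ui e)
    then have "q \<cdot> u = v \<cdot> j" using uniq[OF Comp_hom[OF uh q(2)] Comp_hom[OF j v]] by blast
    moreover have "lifts M j q" using q(1) jC P h by (simp add: acyclic_fibration_iff)
    ultimately obtain k where k: "k \<in> hom M I E" "k \<cdot> j = u" "q \<cdot> k = v"
      using liftsE[OF _ j q(2) uh v] by metis
    have "k \<cdot> (j \<cdot> i\<^sub>0) = u\<^sub>0" "k \<cdot> (j \<cdot> i\<^sub>1) = u\<^sub>1"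
      using h homD[OF k(1)] by (simp_all add: comp_ext[OF k(2)] ui)
    with k show ?thesis by blast
  qed
  moreover have "r \<cdot> (j \<cdot> i\<^sub>0) = Ide M X" "r \<cdot> (j \<cdot> i\<^sub>1) = Ide M X" using eq h by simp_all
  moreover have "(j \<cdot> i\<^sub>0) \<cdot> f = (j \<cdot> i\<^sub>1) \<cdot> f" using h by (simp add: i(5))
  ultimately have "cylinder f X I (j \<cdot> i\<^sub>0) (j \<cdot> i\<^sub>1) r"
    unfolding cylinder_def using Comp_hom[OF i0 j] Comp_hom[OF i1 j] r an by blast
  then show ?thesis by blast
qed

lemma cylinder_of_object:
  assumes "is_cofibrant A"
  obtains Z z I e\<^sub>0 e\<^sub>1 r where "is_initial M Z" "z \<in> hom M Z A" "cylinder z A I e\<^sub>0 e\<^sub>1 r"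
proof -
  obtain Z z where Z: "is_initial M Z" "z \<in> hom M Z A" "z \<in> Cof M" using assms by (rule cofibrantE)
  have "has_relative_strong_cylinder M z"
    using has_strong_cylinder_iff[OF Z(1,2)] strong_cylinder[OF assms] by blast
  then show ?thesis using cylinder_exists[OF Z(3,2) initial_cofibrant[OF Z(1)]] that Z by blast
qed

lemma relative_cylinder:
  assumes "f \<in> Cof M" "f \<in> hom M A X" "is_cofibrant A" "is_fibrant X"
  obtains I e\<^sub>0 e\<^sub>1 r where "cylinder f X I e\<^sub>0 e\<^sub>1 r"
proof -
  have "has_relative_strong_cylinder M f"
    using weak_model assms homD[OF assms(2)] unfolding weak_model_category_def by blast
  then show ?thesis using cylinder_exists[OF assms(1-3)] that by blast
qed

lemma path_object_exists:
  assumes "is_bifibrant X"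
  obtains P s d\<^sub>0 d\<^sub>1 where "path_object X P s d\<^sub>0 d\<^sub>1"
proof -
  obtain T t where T: "is_terminal M T" "t \<in> hom M X T" "t \<in> Fib M" using assms by (blast elim: fibrantE)
  have "has_relative_strong_path M t"
    using weak_model assms T(3) terminal_fibrant[OF T(1)] homD(2,3)[OF T(2)]
    unfolding weak_model_category_def by blast
  then obtain p\<^sub>0 p\<^sub>1 P s q where pb: "is_pullback M t t p\<^sub>0 p\<^sub>1" and
    s: "s \<in> hom M X P" and q0: "q \<in> hom M P (Dom M p\<^sub>0)" and
    eq: "p\<^sub>0 \<cdot> (q \<cdot> s) = Ide M X" "p\<^sub>1 \<cdot> (q \<cdot> s) = Ide M X" and
    qF: "q \<in> Fib M" and ac: "acyclic_fibration M (p\<^sub>0 \<cdot> q)"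
    unfolding has_relative_strong_path_def homD(2)[OF T(2)] by blast
  obtain X1 X2 T' Q where p: "t \<in> hom M X1 T'" "t \<in> hom M X2 T'" "p\<^sub>0 \<in> hom M Q X1" "p\<^sub>1 \<in> hom M Q X2"
    and ex: "\<And>B u v. u \<in> hom M B X1 \<Longrightarrow> v \<in> hom M B X2 \<Longrightarrow> t \<cdot> u = t \<cdot> v
      \<Longrightarrow> \<exists>h \<in> hom M B Q. p\<^sub>0 \<cdot> h = u \<and> p\<^sub>1 \<cdot> h = v"
    and uniq: "\<And>B x y. x \<in> hom M B Q \<Longrightarrow> y \<in> hom M B Q \<Longrightarrow> p\<^sub>0 \<cdot> x = p\<^sub>0 \<cdot> y \<Longrightarrow> p\<^sub>1 \<cdot> x = p\<^sub>1 \<cdot> y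
      \<Longrightarrow> x = y"
    using pullbackE[OF pb] by metis
  have [simp]: "X1 = X" "X2 = X" using p(1,2) T(2) by (auto simp: hom_def)
  have p0: "p\<^sub>0 \<in> hom M Q X" and p1: "p\<^sub>1 \<in> hom M Q X" using p(3,4) by auto
  have q: "q \<in> hom M P Q" using q0 homD(2)[OF p0] by simp
  note h = homD[OF p0] homD[OF p1] homD[OF q] homD[OF s]
  have "\<exists>k \<in> hom M B P. k \<cdot> j = a \<and> (p\<^sub>0 \<cdot> q) \<cdot> k = b\<^sub>0 \<and> (p\<^sub>1 \<cdot> q) \<cdot> k = b\<^sub>1"
    if j: "j \<in> AnCof M" "j \<in> hom M A B" and a: "a \<in> hom M A P"
      and b: "b\<^sub>0 \<in> hom M B X" "b\<^sub>1 \<in> hom M B X"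
      and e: "(p\<^sub>0 \<cdot> q) \<cdot> a = b\<^sub>0 \<cdot> j" "(p\<^sub>1 \<cdot> q) \<cdot> a = b\<^sub>1 \<cdot> j"
    for j A B a b\<^sub>0 b\<^sub>1
  proof -
    have "t \<cdot> b\<^sub>0 = t \<cdot> b\<^sub>1" using terminal_unique[OF T(1) Comp_hom[OF b(1) T(2)] Comp_hom[OF b(2) T(2)]] .
    then obtain v where v: "v \<in> hom M B Q" and pv: "p\<^sub>0 \<cdot> v = b\<^sub>0" "p\<^sub>1 \<cdot> v = b\<^sub>1"
      using ex[of b\<^sub>0 B b\<^sub>1] b by auto
    have "p\<^sub>0 \<cdot> (q \<cdot> a) = p\<^sub>0 \<cdot> (v \<cdot> j)" "p\<^sub>1 \<cdot> (q \<cdot> a) = p\<^sub>1 \<cdot> (v \<cdot> j)"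
      using e h homD[OF j(2)] homD[OF a] homD[OF v] by (simp_all add: comp_ext[OF pv(1)] comp_ext[OF pv(2)])
    then have "q \<cdot> a = v \<cdot> j" using uniq[OF Comp_hom[OF a q] Comp_hom[OF j(2) v]] by blast
    then obtain k where k: "k \<in> hom M B P" "k \<cdot> j = a" "q \<cdot> k = v"
      using liftsE[OF wfs_lifts[OF AnCof_wfs j(1) qF] j(2) q a v] by metis
    have "(p\<^sub>0 \<cdot> q) \<cdot> k = b\<^sub>0" "(p\<^sub>1 \<cdot> q) \<cdot> k = b\<^sub>1"
      using h homD[OF k(1)] by (simp_all add: k(3) pv)
    with k show ?thesis by blast
  qed
  moreover have "(p\<^sub>0 \<cdot> q) \<cdot> s = Ide M X" "(p\<^sub>1 \<cdot> q) \<cdot> s = Ide M X" using eq h by simp_all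
  ultimately have "path_object X P s (p\<^sub>0 \<cdot> q) (p\<^sub>1 \<cdot> q)"
    unfolding path_object_def using Comp_hom[OF q p0] Comp_hom[OF q p1] s ac by blast
  then show ?thesis by (rule that)
qed

text \<open>Right homotopy, since it is visibly stable under precomposition. That it is an equivalence
  relation, and the same as left homotopy for any cylinder of \<open>A\<close>, follows from the lifting
  properties of cylinders and path objects.\<close>

definition homotopic :: "'o \<Rightarrow> 'o \<Rightarrow> 'a \<Rightarrow> 'a \<Rightarrow> bool" where
  "homotopic A X f g \<longleftrightarrow>
     (\<exists>P s d\<^sub>0 d\<^sub>1 h. path_object X P s d\<^sub>0 d\<^sub>1 \<and> h \<in> hom M A P \<and> d\<^sub>0 \<cdot> h = f \<and> d\<^sub>1 \<cdot> h = g)"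

lemma homotopicE:
  assumes "homotopic A X f g"
  obtains P s d\<^sub>0 d\<^sub>1 h where "path_object X P s d\<^sub>0 d\<^sub>1" "h \<in> hom M A P" "d\<^sub>0 \<cdot> h = f" "d\<^sub>1 \<cdot> h = g"
  using assms unfolding homotopic_def by blast

lemma homotopic_hom: "homotopic A X f g \<Longrightarrow> f \<in> hom M A X \<and> g \<in> hom M A X"
  by (elim homotopicE) (metis Comp_hom path_objectD(2,3))

lemma homotopic_refl:
  assumes "is_bifibrant X" "f \<in> hom M A X"
  shows "homotopic A X f f"
proof -
  obtain P s d\<^sub>0 d\<^sub>1 where P: "path_object X P s d\<^sub>0 d\<^sub>1" using path_object_exists[OF assms(1)] .
  note p = path_objectD[OF P]
  have "d\<^sub>0 \<cdot> (s \<cdot> f) = f" "d\<^sub>1 \<cdot> (s \<cdot> f) = f"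
    using homD[OF p(1)] homD[OF p(2)] homD[OF p(3)] homD[OF assms(2)]
    by (simp_all add: comp_ext[OF p(4)] comp_ext[OF p(5)])
  then show ?thesis using P Comp_hom[OF assms(2) p(1)] unfolding homotopic_def by blast
qed

lemma homotopic_precompose:
  assumes "homotopic A X f g" "x \<in> hom M B A"
  shows "homotopic B X (f \<cdot> x) (g \<cdot> x)"
proof -
  obtain P s d\<^sub>0 d\<^sub>1 h where P: "path_object X P s d\<^sub>0 d\<^sub>1" and h: "h \<in> hom M A P" "d\<^sub>0 \<cdot> h = f" "d\<^sub>1 \<cdot> h = g"
    using assms(1) by (rule homotopicE)
  note p = path_objectD[OF P]
  have "d\<^sub>0 \<cdot> (h \<cdot> x) = f \<cdot> x" "d\<^sub>1 \<cdot> (h \<cdot> x) = g \<cdot> x"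
    using homD[OF p(2)] homD[OF p(3)] homD[OF assms(2)] homD[OF h(1)]
    by (simp_all add: comp_ext[OF h(2)] comp_ext[OF h(3)])
  then show ?thesis using P Comp_hom[OF assms(2) h(1)] unfolding homotopic_def by blast
qed

text \<open>A left homotopy starts as a constant path along the anodyne inclusion of its first end, and
  this path extends over the cylinder.\<close>

lemma left_homotopic_homotopic:
  assumes "cylinder z A I e\<^sub>0 e\<^sub>1 r" "H \<in> hom M I X" "is_bifibrant X"
  shows "homotopic A X (H \<cdot> e\<^sub>0) (H \<cdot> e\<^sub>1)"
proof -
  note c = cylinderD[OF assms(1)]
  obtain P s d\<^sub>0 d\<^sub>1 where P: "path_object X P s d\<^sub>0 d\<^sub>1" using path_object_exists[OF assms(3)] .
  note p = path_objectD[OF P]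
  define f where "f = H \<cdot> e\<^sub>0"
  have f: "f \<in> hom M A X" unfolding f_def using Comp_hom[OF c(1) assms(2)] .
  note h = homD[OF c(1)] homD[OF c(2)] homD[OF c(3)] homD[OF p(1)] homD[OF p(2)] homD[OF p(3)]
    homD[OF assms(2)] homD[OF f]
  have fr: "f \<cdot> r \<in> hom M I X" using Comp_hom[OF c(3) f] .
  have "d\<^sub>0 \<cdot> (s \<cdot> f) = (f \<cdot> r) \<cdot> e\<^sub>0" "d\<^sub>1 \<cdot> (s \<cdot> f) = H \<cdot> e\<^sub>0"
    using h by (simp_all add: comp_ext[OF p(4)] comp_ext[OF p(5)] c(5) flip: f_def)
  then obtain L where L: "L \<in> hom M I P" "L \<cdot> e\<^sub>0 = s \<cdot> f" "d\<^sub>0 \<cdot> L = f \<cdot> r" "d\<^sub>1 \<cdot> L = H"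
    using path_object_lift[OF P c(7,1) Comp_hom[OF f p(1)] fr assms(2)] by metis
  have "d\<^sub>0 \<cdot> (L \<cdot> e\<^sub>1) = f" "d\<^sub>1 \<cdot> (L \<cdot> e\<^sub>1) = H \<cdot> e\<^sub>1"
    using h homD[OF L(1)] by (simp_all add: comp_ext[OF L(3)] comp_ext[OF L(4)] c(6))
  then show ?thesis
    using P Comp_hom[OF c(2) L(1)] unfolding homotopic_def f_def by blast
qed

lemma homotopic_left_homotopic:
  assumes "homotopic A X f g" "is_initial M Z" "z \<in> hom M Z A" "cylinder z A I e\<^sub>0 e\<^sub>1 r"
  obtains H where "H \<in> hom M I X" "H \<cdot> e\<^sub>0 = f" "H \<cdot> e\<^sub>1 = g"
proof -
  obtain P s d\<^sub>0 d\<^sub>1 h where P: "path_object X P s d\<^sub>0 d\<^sub>1" and h: "h \<in> hom M A P" "d\<^sub>0 \<cdot> h = f" "d\<^sub>1 \<cdot> h = g"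
    using assms(1) by (rule homotopicE)
  note p = path_objectD[OF P] and c = cylinderD[OF assms(4)]
  have f: "f \<in> hom M A X" using homotopic_hom[OF assms(1)] by blast
  note hs = homD[OF c(1)] homD[OF c(2)] homD[OF c(3)] homD[OF p(1)] homD[OF p(2)] homD[OF p(3)]
    homD[OF h(1)] homD[OF f]
  have sf: "s \<cdot> f \<in> hom M A P" and fr: "f \<cdot> r \<in> hom M I X"
    using Comp_hom[OF f p(1)] Comp_hom[OF c(3) f] .
  have "(s \<cdot> f) \<cdot> z = h \<cdot> z"
    using initial_unique[OF assms(2) Comp_hom[OF assms(3) sf] Comp_hom[OF assms(3) h(1)]] .
  moreover have "d\<^sub>0 \<cdot> (s \<cdot> f) = (f \<cdot> r) \<cdot> e\<^sub>0" "d\<^sub>0 \<cdot> h = (f \<cdot> r) \<cdot> e\<^sub>1"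
    using hs by (simp_all add: comp_ext[OF p(4)] c(5,6) h(2))
  ultimately obtain L where L: "L \<in> hom M I P" "L \<cdot> e\<^sub>0 = s \<cdot> f" "L \<cdot> e\<^sub>1 = h"
    using cylinder_lift[OF assms(4) p(6,2) sf h(1) fr] by metis
  have "(d\<^sub>1 \<cdot> L) \<cdot> e\<^sub>0 = f" "(d\<^sub>1 \<cdot> L) \<cdot> e\<^sub>1 = g"
    using hs homD[OF L(1)] by (simp_all add: L comp_ext[OF p(5)] h(3))
  then show ?thesis using that Comp_hom[OF L(1) p(3)] by blast
qed

text \<open>Two left homotopies that start at \<open>f\<close> combine to a map from the cylinder to \<open>X \<times> X\<close> whose
  value at the first end lifts to the constant path at \<open>f\<close>. The lift over the whole cylinder is a
  path from \<open>g\<close> to \<open>k\<close> at the second end.\<close>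

lemma homotopic_euclidean:
  assumes "is_cofibrant A" "homotopic A X f g" "homotopic A X f k"
  shows "homotopic A X g k"
proof -
  obtain Z z I e\<^sub>0 e\<^sub>1 r where Z: "is_initial M Z" "z \<in> hom M Z A" and C: "cylinder z A I e\<^sub>0 e\<^sub>1 r"
    using cylinder_of_object[OF assms(1)] .
  obtain P s d\<^sub>0 d\<^sub>1 where P: "path_object X P s d\<^sub>0 d\<^sub>1" using assms(2) by (rule homotopicE)
  obtain G where G: "G \<in> hom M I X" "G \<cdot> e\<^sub>0 = f" "G \<cdot> e\<^sub>1 = g"
    using homotopic_left_homotopic[OF assms(2) Z C] .
  obtain H where H: "H \<in> hom M I X" "H \<cdot> e\<^sub>0 = f" "H \<cdot> e\<^sub>1 = k"
    using homotopic_left_homotopic[OF assms(3) Z C] .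
  note p = path_objectD[OF P] and c = cylinderD[OF C]
  have f: "f \<in> hom M A X" using homotopic_hom[OF assms(2)] by blast
  note hs = homD[OF c(1)] homD[OF c(2)] homD[OF p(1)] homD[OF p(2)] homD[OF p(3)] homD[OF f]
  have "d\<^sub>0 \<cdot> (s \<cdot> f) = G \<cdot> e\<^sub>0" "d\<^sub>1 \<cdot> (s \<cdot> f) = H \<cdot> e\<^sub>0"
    using hs by (simp_all add: comp_ext[OF p(4)] comp_ext[OF p(5)] G H)
  then obtain L where L: "L \<in> hom M I P" "d\<^sub>0 \<cdot> L = G" "d\<^sub>1 \<cdot> L = H"
    using path_object_lift[OF P c(7,1) Comp_hom[OF f p(1)] G(1) H(1)] by metis
  have "d\<^sub>0 \<cdot> (L \<cdot> e\<^sub>1) = g" "d\<^sub>1 \<cdot> (L \<cdot> e\<^sub>1) = k"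
    using hs homD[OF L(1)] by (simp_all add: comp_ext[OF L(2)] comp_ext[OF L(3)] G H)
  then show ?thesis using P Comp_hom[OF c(2) L(1)] unfolding homotopic_def by blast
qed

lemma homotopic_sym:
  assumes "is_cofibrant A" "is_bifibrant X" "homotopic A X f g"
  shows "homotopic A X g f"
  using homotopic_euclidean[OF assms(1,3)] homotopic_refl[OF assms(2)] homotopic_hom[OF assms(3)] by blast

lemma homotopic_trans:
  assumes "is_cofibrant A" "is_bifibrant X" "homotopic A X f g" "homotopic A X g k"
  shows "homotopic A X f k"
  using homotopic_euclidean[OF assms(1) homotopic_sym[OF assms(1-3)] assms(4)] .

text \<open>The homotopy extension property: the homotopy extends because the first projection of a path
  object is an acyclic fibration.\<close>

lemma homotopy_extension:
  assumes "i \<in> Cof M" "i \<in> hom M A B" "is_cofibrant A" "w \<in> hom M B X" "homotopic A X (w \<cdot> i) u"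
  obtains w' where "w' \<in> hom M B X" "w' \<cdot> i = u" "homotopic B X w w'"
proof -
  obtain P s d\<^sub>0 d\<^sub>1 h where P: "path_object X P s d\<^sub>0 d\<^sub>1" and
    h: "h \<in> hom M A P" "d\<^sub>0 \<cdot> h = w \<cdot> i" "d\<^sub>1 \<cdot> h = u"
    using assms(5) by (rule homotopicE)
  note p = path_objectD[OF P]
  have "lifts M i d\<^sub>0" using p(6) assms(1,3) homD[OF assms(2)] by (simp add: acyclic_fibration_iff)
  then obtain H where H: "H \<in> hom M B P" "H \<cdot> i = h" "d\<^sub>0 \<cdot> H = w"
    using liftsE[OF _ assms(2) p(2) h(1) assms(4) h(2)] by metis
  have "(d\<^sub>1 \<cdot> H) \<cdot> i = u" using homD[OF p(3)] homD[OF H(1)] homD[OF assms(2)] by (simp add: H h)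
  moreover have "homotopic B X w (d\<^sub>1 \<cdot> H)" using P H unfolding homotopic_def by blast
  ultimately show ?thesis using that Comp_hom[OF H(1) p(3)] by blast
qed

end

section \<open>Equivalences between cofibrant objects\<close>

context cylindrical_structure
begin

text \<open>Precomposition with \<open>f\<close> is bijective on homotopy classes of maps to bifibrant objects. With
  this choice 2-out-of-3 and stability under retracts are formal, and all of the content is in
  showing that the core cofibrations among these maps are anodyne.\<close>

definition core_equivalence :: "'o \<Rightarrow> 'o \<Rightarrow> 'a \<Rightarrow> bool" where
  "core_equivalence A B f \<longleftrightarrow> f \<in> hom M A B \<and> (\<forall>X. is_bifibrant X \<longrightarrow>
     (\<forall>u \<in> hom M A X. \<exists>v \<in> hom M B X. homotopic A X (v \<cdot> f) u) \<and>
     (\<forall>v \<in> hom M B X. \<forall>v' \<in> hom M B X. homotopic A X (v \<cdot> f) (v' \<cdot> f) \<longrightarrow> homotopic B X v v'))"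

text \<open>The congruence that this notion of homotopy induces on all maps between cofibrant objects.\<close>

definition identified :: "'o \<Rightarrow> 'o \<Rightarrow> 'a \<Rightarrow> 'a \<Rightarrow> bool" where
  "identified A B f g \<longleftrightarrow> f \<in> hom M A B \<and> g \<in> hom M A B \<and>
     (\<forall>X. is_bifibrant X \<longrightarrow> (\<forall>v \<in> hom M B X. homotopic A X (v \<cdot> f) (v \<cdot> g)))"

lemma core_equivalence_hom: "core_equivalence A B f \<Longrightarrow> f \<in> hom M A B"
  by (simp add: core_equivalence_def)

lemma core_equivalence_surj:
  assumes "core_equivalence A B f" "is_bifibrant X" "u \<in> hom M A X"
  obtains v where "v \<in> hom M B X" "homotopic A X (v \<cdot> f) u"
  using assms unfolding core_equivalence_def by blast

lemma core_equivalence_inj: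
  assumes "core_equivalence A B f" "is_bifibrant X" "v \<in> hom M B X" "v' \<in> hom M B X"
    "homotopic A X (v \<cdot> f) (v' \<cdot> f)"
  shows "homotopic B X v v'"
  using assms unfolding core_equivalence_def by blast

lemma core_equivalenceI:
  assumes "f \<in> hom M A B"
    "\<And>X u. is_bifibrant X \<Longrightarrow> u \<in> hom M A X \<Longrightarrow> \<exists>v \<in> hom M B X. homotopic A X (v \<cdot> f) u"
    "\<And>X v v'. is_bifibrant X \<Longrightarrow> v \<in> hom M B X \<Longrightarrow> v' \<in> hom M B X
      \<Longrightarrow> homotopic A X (v \<cdot> f) (v' \<cdot> f) \<Longrightarrow> homotopic B X v v'"
  shows "core_equivalence A B f"
  using assms unfolding core_equivalence_def by blast

lemma identifiedD:
  assumes "identified A B f g"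
  shows "f \<in> hom M A B" "g \<in> hom M A B"
    "is_bifibrant X \<Longrightarrow> v \<in> hom M B X \<Longrightarrow> homotopic A X (v \<cdot> f) (v \<cdot> g)"
  using assms unfolding identified_def by blast+

lemma identified_refl: "f \<in> hom M A B \<Longrightarrow> identified A B f f"
  using homotopic_refl Comp_hom unfolding identified_def by blast

text \<open>Lifting a constant homotopy against an anodyne fibration compares any two lifts of a map.
  This is where cofibrant objects that are not fibrant must have strong cylinders.\<close>

lemma lifts_identified:
  assumes "is_cofibrant A" "q \<in> AnFib M" "q \<in> hom M E Y" "f \<in> hom M A E" "g \<in> hom M A E"
    "q \<cdot> f = q \<cdot> g"
  shows "identified A E f g"
proof -
  obtain Z z I e\<^sub>0 e\<^sub>1 r where Z: "is_initial M Z" "z \<in> hom M Z A" and C: "cylinder z A I e\<^sub>0 e\<^sub>1 r"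
    using cylinder_of_object[OF assms(1)] .
  note c = cylinderD[OF C]
  note hs = homD[OF c(1)] homD[OF c(2)] homD[OF c(3)] homD[OF assms(3)] homD[OF assms(4)]
    homD[OF assms(5)]
  have v: "(q \<cdot> f) \<cdot> r \<in> hom M I Y" using Comp_hom[OF c(3) Comp_hom[OF assms(4,3)]] .
  have "f \<cdot> z = g \<cdot> z"
    using initial_unique[OF Z(1) Comp_hom[OF Z(2) assms(4)] Comp_hom[OF Z(2) assms(5)]] .
  moreover have "q \<cdot> f = ((q \<cdot> f) \<cdot> r) \<cdot> e\<^sub>0" "q \<cdot> g = ((q \<cdot> f) \<cdot> r) \<cdot> e\<^sub>1"
    using hs by (simp_all add: c(5,6) assms(6))
  ultimately obtain H where H: "H \<in> hom M I E" "H \<cdot> e\<^sub>0 = f" "H \<cdot> e\<^sub>1 = g"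
    using cylinder_lift[OF C AnFib_acyclic_fibration[OF assms(2)] assms(3-5) v] by metis
  have "homotopic A X (w \<cdot> f) (w \<cdot> g)" if X: "is_bifibrant X" and w: "w \<in> hom M E X" for X w
  proof -
    have "(w \<cdot> H) \<cdot> e\<^sub>0 = w \<cdot> f" "(w \<cdot> H) \<cdot> e\<^sub>1 = w \<cdot> g"
      using hs homD[OF H(1)] homD[OF w] by (simp_all add: H)
    then show ?thesis using left_homotopic_homotopic[OF C Comp_hom[OF H(1) w] X] by simp
  qed
  then show ?thesis using assms(4,5) unfolding identified_def by blast
qed

lemma core_equivalence_comp:
  assumes "is_cofibrant A" "core_equivalence A B f" "core_equivalence B D g"
  shows "core_equivalence A D (g \<cdot> f)"
proof (rule core_equivalenceI)
  note f = core_equivalence_hom[OF assms(2)] and g = core_equivalence_hom[OF assms(3)]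
  note hs = homD[OF f] homD[OF g]
  show "g \<cdot> f \<in> hom M A D" using Comp_hom[OF f g] .
  fix X assume X: "is_bifibrant X"
  { fix u assume u: "u \<in> hom M A X"
    obtain v where v: "v \<in> hom M B X" "homotopic A X (v \<cdot> f) u"
      using core_equivalence_surj[OF assms(2) X u] .
    obtain w where w: "w \<in> hom M D X" "homotopic B X (w \<cdot> g) v"
      using core_equivalence_surj[OF assms(3) X v(1)] .
    have "(w \<cdot> g) \<cdot> f = w \<cdot> (g \<cdot> f)" using hs homD[OF w(1)] by simp
    then have "homotopic A X (w \<cdot> (g \<cdot> f)) u"
      using homotopic_trans[OF assms(1) X homotopic_precompose[OF w(2) f] v(2)] by simp
    with w show "\<exists>w \<in> hom M D X. homotopic A X (w \<cdot> (g \<cdot> f)) u" by blast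
  next
    fix v v' assume v: "v \<in> hom M D X" "v' \<in> hom M D X"
      and H: "homotopic A X (v \<cdot> (g \<cdot> f)) (v' \<cdot> (g \<cdot> f))"
    have "homotopic A X ((v \<cdot> g) \<cdot> f) ((v' \<cdot> g) \<cdot> f)"
      using H hs homD[OF v(1)] homD[OF v(2)] by simp
    from core_equivalence_inj[OF assms(2) X Comp_hom[OF g v(1)] Comp_hom[OF g v(2)] this]
    show "homotopic D X v v'" using core_equivalence_inj[OF assms(3) X v] by blast
  }
qed

lemma core_equivalence_cancel_right:
  assumes "is_cofibrant A" "core_equivalence A B f" "core_equivalence A D (g \<cdot> f)" "g \<in> hom M B D"
  shows "core_equivalence B D g"
proof (rule core_equivalenceI[OF assms(4)])
  note f = core_equivalence_hom[OF assms(2)]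
  note hs = homD[OF f] homD[OF assms(4)]
  fix X assume X: "is_bifibrant X"
  { fix u assume u: "u \<in> hom M B X"
    obtain w where w: "w \<in> hom M D X" "homotopic A X (w \<cdot> (g \<cdot> f)) (u \<cdot> f)"
      using core_equivalence_surj[OF assms(3) X Comp_hom[OF f u]] .
    then have "homotopic A X ((w \<cdot> g) \<cdot> f) (u \<cdot> f)" using hs homD[OF w(1)] by simp
    then have "homotopic B X (w \<cdot> g) u"
      using core_equivalence_inj[OF assms(2) X Comp_hom[OF assms(4) w(1)] u] by blast
    with w show "\<exists>w \<in> hom M D X. homotopic B X (w \<cdot> g) u" by blast
  next
    fix v v' assume v: "v \<in> hom M D X" "v' \<in> hom M D X" and H: "homotopic B X (v \<cdot> g) (v' \<cdot> g)"
    have "homotopic A X (v \<cdot> (g \<cdot> f)) (v' \<cdot> (g \<cdot> f))"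
      using homotopic_precompose[OF H f] hs homD[OF v(1)] homD[OF v(2)] by simp
    then show "homotopic D X v v'" using core_equivalence_inj[OF assms(3) X v] by blast
  }
qed

lemma core_equivalence_cancel_left:
  assumes "is_cofibrant A" "is_cofibrant B" "core_equivalence B D g" "core_equivalence A D (g \<cdot> f)"
    "f \<in> hom M A B"
  shows "core_equivalence A B f"
proof (rule core_equivalenceI[OF assms(5)])
  note g = core_equivalence_hom[OF assms(3)]
  note hs = homD[OF g] homD[OF assms(5)]
  fix X assume X: "is_bifibrant X"
  { fix u assume u: "u \<in> hom M A X"
    obtain w where w: "w \<in> hom M D X" "homotopic A X (w \<cdot> (g \<cdot> f)) u"
      using core_equivalence_surj[OF assms(4) X u] .
    then have "homotopic A X ((w \<cdot> g) \<cdot> f) u" using hs homD[OF w(1)] by simp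
    with Comp_hom[OF g w(1)] show "\<exists>v \<in> hom M B X. homotopic A X (v \<cdot> f) u" by blast
  next
    fix v v' assume v: "v \<in> hom M B X" "v' \<in> hom M B X" and H: "homotopic A X (v \<cdot> f) (v' \<cdot> f)"
    obtain w where w: "w \<in> hom M D X" "homotopic B X (w \<cdot> g) v"
      using core_equivalence_surj[OF assms(3) X v(1)] .
    obtain w' where w': "w' \<in> hom M D X" "homotopic B X (w' \<cdot> g) v'"
      using core_equivalence_surj[OF assms(3) X v(2)] .
    note 1 = homotopic_precompose[OF w(2) assms(5)] and 2 = homotopic_precompose[OF w'(2) assms(5)]
    have "homotopic A X ((w \<cdot> g) \<cdot> f) ((w' \<cdot> g) \<cdot> f)"
      using homotopic_trans[OF assms(1) X homotopic_trans[OF assms(1) X 1 H] homotopic_sym[OF assms(1) X 2]] .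
    then have "homotopic A X (w \<cdot> (g \<cdot> f)) (w' \<cdot> (g \<cdot> f))"
      using hs homD[OF w(1)] homD[OF w'(1)] by simp
    then have "homotopic D X w w'" using core_equivalence_inj[OF assms(4) X w(1) w'(1)] by blast
    then have "homotopic B X (w \<cdot> g) (w' \<cdot> g)" using homotopic_precompose g by blast
    then show "homotopic B X v v'"
      using homotopic_trans[OF assms(2) X homotopic_euclidean[OF assms(2) w(2)] w'(2)] by blast
  }
qed

text \<open>Closure under retracts up to identification also covers two special cases: invariance
  under identification, and homotopy equivalences as retracts of an identity.\<close>

lemma core_equivalence_retract:
  assumes "is_cofibrant A" "is_cofibrant B" "core_equivalence A' B' g" "f \<in> hom M A B"
    "s \<in> hom M A A'" "r \<in> hom M A' A" "s' \<in> hom M B B'" "r' \<in> hom M B' B"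
    "is_cofibrant A'"
    "identified A A (r \<cdot> s) (Ide M A)" "identified B B (r' \<cdot> s') (Ide M B)"
    "identified A B' (g \<cdot> s) (s' \<cdot> f)" "identified A' B (f \<cdot> r) (r' \<cdot> g)"
  shows "core_equivalence A B f"
proof (rule core_equivalenceI[OF assms(4)])
  note g = core_equivalence_hom[OF assms(3)]
  note hs = homD[OF g] homD[OF assms(4)] homD[OF assms(5)] homD[OF assms(6)] homD[OF assms(7)]
    homD[OF assms(8)]
  fix X assume X: "is_bifibrant X"
  note trans = homotopic_trans[OF _ X]
  { fix u assume u: "u \<in> hom M A X"
    obtain v where v: "v \<in> hom M B' X" "homotopic A' X (v \<cdot> g) (u \<cdot> r)"
      using core_equivalence_surj[OF assms(3) X Comp_hom[OF assms(6) u]] .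
    have 1: "homotopic A X (v \<cdot> (s' \<cdot> f)) (v \<cdot> (g \<cdot> s))"
      using homotopic_sym[OF assms(1) X identifiedD(3)[OF assms(12) X v(1)]] .
    have 2: "homotopic A X (v \<cdot> (g \<cdot> s)) (u \<cdot> (r \<cdot> s))"
      using homotopic_precompose[OF v(2) assms(5)] hs homD[OF u] homD[OF v(1)] by simp
    have 3: "homotopic A X (u \<cdot> (r \<cdot> s)) u"
      using identifiedD(3)[OF assms(10) X u] homD[OF u] by simp
    have "homotopic A X (v \<cdot> (s' \<cdot> f)) u" using trans[OF assms(1) 1 trans[OF assms(1) 2 3]] .
    then have "homotopic A X ((v \<cdot> s') \<cdot> f) u" using hs homD[OF v(1)] by simp
    then show "\<exists>v \<in> hom M B X. homotopic A X (v \<cdot> f) u" using Comp_hom[OF assms(7) v(1)] by blast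
  next
    fix v v' assume v: "v \<in> hom M B X" "v' \<in> hom M B X" and H: "homotopic A X (v \<cdot> f) (v' \<cdot> f)"
    have 1: "homotopic A' X (w \<cdot> (f \<cdot> r)) (w \<cdot> (r' \<cdot> g))" if "w \<in> hom M B X" for w
      using identifiedD(3)[OF assms(13) X that] .
    have 2: "homotopic A' X (v \<cdot> (f \<cdot> r)) (v' \<cdot> (f \<cdot> r))"
      using homotopic_precompose[OF H assms(6)] hs homD[OF v(1)] homD[OF v(2)] by simp
    have "homotopic A' X (v \<cdot> (r' \<cdot> g)) (v' \<cdot> (r' \<cdot> g))"
      using homotopic_trans[OF assms(9) X homotopic_euclidean[OF assms(9) 1[OF v(1)] 2] 1[OF v(2)]] .
    then have "homotopic A' X ((v \<cdot> r') \<cdot> g) ((v' \<cdot> r') \<cdot> g)"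
      using hs homD[OF v(1)] homD[OF v(2)] by simp
    then have "homotopic B' X (v \<cdot> r') (v' \<cdot> r')"
      using core_equivalence_inj[OF assms(3) X Comp_hom[OF assms(8) v(1)] Comp_hom[OF assms(8) v(2)]]
      by blast
    from homotopic_precompose[OF this assms(7)]
    have 3: "homotopic B X (v \<cdot> (r' \<cdot> s')) (v' \<cdot> (r' \<cdot> s'))"
      using hs homD[OF v(1)] homD[OF v(2)] by simp
    have 4: "homotopic B X (w \<cdot> (r' \<cdot> s')) w" if "w \<in> hom M B X" for w
      using identifiedD(3)[OF assms(11) X that] homD[OF that] by simp
    show "homotopic B X v v'"
      using homotopic_trans[OF assms(2) X homotopic_euclidean[OF assms(2) 4[OF v(1)] 3] 4[OF v(2)]] .
  }
qed

lemma core_equivalence_Ide: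
  assumes "is_cofibrant A"
  shows "core_equivalence A A (Ide M A)"
proof (rule core_equivalenceI)
  have A: "A \<in> Obj M" using cofibrant_Obj[OF assms] .
  then show "Ide M A \<in> hom M A A" by (rule Ide_hom)
  fix X assume X: "is_bifibrant X"
  have eq: "u \<cdot> Ide M A = u" if "u \<in> hom M A X" for u using homD[OF that] by simp
  show "\<exists>v \<in> hom M A X. homotopic A X (v \<cdot> Ide M A) u" if "u \<in> hom M A X" for u
    using that eq homotopic_refl[OF X] by metis
  show "homotopic A X v v'" if "v \<in> hom M A X" "v' \<in> hom M A X"
    "homotopic A X (v \<cdot> Ide M A) (v' \<cdot> Ide M A)" for v v'
    using that eq by simp
qed

lemma core_equivalence_identified:
  assumes "is_cofibrant A" "is_cofibrant B" "core_equivalence A B g" "identified A B f g"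
  shows "core_equivalence A B f"
proof -
  note f = identifiedD(1)[OF assms(4)] and g = identifiedD(2)[OF assms(4)]
  have I: "Ide M A \<in> hom M A A" "Ide M B \<in> hom M B B"
    using homD(4,5)[OF f] by (auto intro: Ide_hom)
  have sym: "identified A B g f"
    using assms(4) homotopic_sym[OF assms(1)] unfolding identified_def by blast
  show ?thesis
    by (rule core_equivalence_retract[OF assms(1-3) f I(1) I(1) I(2) I(2) assms(1)])
      (use homD[OF f] homD[OF g] assms(4) sym identified_refl[OF I(1)] identified_refl[OF I(2)]
        in simp_all)
qed

lemma homotopy_equivalence_core_equivalence:
  assumes "is_cofibrant A" "is_cofibrant B" "x \<in> hom M A B" "y \<in> hom M B A"
    "identified A A (y \<cdot> x) (Ide M A)" "identified B B (x \<cdot> y) (Ide M B)"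
  shows "core_equivalence A B x"
proof -
  have I: "Ide M A \<in> hom M A A" using homD(4)[OF assms(3)] by (rule Ide_hom)
  have sym: "identified A A (Ide M A) (y \<cdot> x)"
    using assms(5) homotopic_sym[OF assms(1)] unfolding identified_def by blast
  show ?thesis
    by (rule core_equivalence_retract[OF assms(1,2) core_equivalence_Ide[OF assms(1)] assms(3)
          I I assms(4,3,1)])
      (use homD[OF assms(3)] assms(6) sym identified_refl[OF I] identified_refl[OF assms(3)]
        in simp_all)
qed

lemma core_AnCof_core_equivalence:
  assumes "i \<in> AnCof M" "i \<in> hom M A B"
  shows "core_equivalence A B i"
proof (rule core_equivalenceI[OF assms(2)])
  fix X assume X: "is_bifibrant X"
  show "\<exists>v \<in> hom M B X. homotopic A X (v \<cdot> i) u" if u: "u \<in> hom M A X" for u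
    using fibrant_extension[OF _ assms u] X homotopic_refl[OF X u] by metis
  fix v v' assume v: "v \<in> hom M B X" "v' \<in> hom M B X" and H: "homotopic A X (v \<cdot> i) (v' \<cdot> i)"
  obtain P s d\<^sub>0 d\<^sub>1 h where P: "path_object X P s d\<^sub>0 d\<^sub>1" and
    h: "h \<in> hom M A P" "d\<^sub>0 \<cdot> h = v \<cdot> i" "d\<^sub>1 \<cdot> h = v' \<cdot> i"
    using H by (rule homotopicE)
  show "homotopic B X v v'"
    using path_object_lift[OF P assms h(1) v h(2,3)] P unfolding homotopic_def by metis
qed

text \<open>Put \<open>j = t \<cdot> c\<close> and let \<open>y\<close> be the section of \<open>t\<close> with \<open>y \<cdot> j = c\<close>. By lifting against \<open>t\<close>,
  the composite \<open>y \<cdot> t\<close> is homotopic to the identity over \<open>E\<close> and relative to \<open>A\<close>. Hence a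
  lifting problem for \<open>c\<close> can be solved up to that homotopy by one for \<open>j\<close>, and the homotopy is
  then lifted from its anodyne end.\<close>

lemma anodyne_of_anodyne_fibration_comp:
  assumes "c \<in> Cof M" "c \<in> hom M A C" "is_cofibrant A" "is_fibrant C"
    "t \<in> AnFib M" "t \<in> hom M C E" "t \<cdot> c \<in> AnCof M"
  shows "c \<in> AnCof M"
proof (rule wfs_leftI[OF AnCof_wfs homD(1)[OF assms(2)]])
  fix p assume pF: "p \<in> Fib M"
  define j where "j = t \<cdot> c"
  have j: "j \<in> hom M A E" "j \<in> AnCof M"
    unfolding j_def using Comp_hom[OF assms(2,6)] assms(7) by auto
  have IE: "Ide M E \<in> hom M E E" and IC: "Ide M C \<in> hom M C C"
    using homD(4,5)[OF assms(6)] by (auto intro: Ide_hom)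
  note hs = homD[OF assms(2)] homD[OF assms(6)] homD[OF j(1)]
  have "t \<cdot> c = Ide M E \<cdot> j" using hs j_def by simp
  then obtain y where y: "y \<in> hom M E C" "y \<cdot> j = c" "t \<cdot> y = Ide M E"
    using liftsE[OF wfs_lifts[OF Cof_wfs AnCof_Cof[OF j(2)] assms(5)] j(1) assms(6,2) IE] by metis
  obtain I e\<^sub>0 e\<^sub>1 r where C: "cylinder c C I e\<^sub>0 e\<^sub>1 r" using relative_cylinder[OF assms(1-4)] .
  note k = cylinderD[OF C]
  note hs = hs homD[OF y(1)] homD[OF k(1)] homD[OF k(2)] homD[OF k(3)]
  have yt: "y \<cdot> t \<in> hom M C C" and tr: "t \<cdot> r \<in> hom M I E"
    using Comp_hom[OF assms(6) y(1)] Comp_hom[OF k(3) assms(6)] .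
  have "(y \<cdot> t) \<cdot> c = Ide M C \<cdot> c" using hs y(2) by (simp flip: j_def)
  moreover have "t \<cdot> (y \<cdot> t) = (t \<cdot> r) \<cdot> e\<^sub>0" "t \<cdot> Ide M C = (t \<cdot> r) \<cdot> e\<^sub>1"
    using hs by (simp_all add: comp_ext[OF y(3)] k(5,6))
  ultimately obtain H where H: "H \<in> hom M I C" "H \<cdot> e\<^sub>0 = y \<cdot> t" "H \<cdot> e\<^sub>1 = Ide M C"
    using cylinder_lift[OF C AnFib_acyclic_fibration[OF assms(5)] assms(6) yt IC tr] by metis
  show "lifts M c p"
  proof (rule liftsI[OF assms(2)])
    show p: "p \<in> hom M (Dom M p) (Cod M p)"
      using wfs_right_Arr[OF AnCof_wfs pF] by (auto intro: homI)
    fix u v assume u: "u \<in> hom M A (Dom M p)" and v: "v \<in> hom M C (Cod M p)" and pu: "p \<cdot> u = v \<cdot> c"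
    note hs = hs homD[OF u] homD[OF v] homD[OF p] homD[OF H(1)]
    have "p \<cdot> u = (v \<cdot> y) \<cdot> j" using hs y(2) pu by simp
    then obtain h where h: "h \<in> hom M E (Dom M p)" "h \<cdot> j = u" "p \<cdot> h = v \<cdot> y"
      using liftsE[OF wfs_lifts[OF AnCof_wfs j(2) pF] j(1) p u Comp_hom[OF y(1) v]] by metis
    note hs = hs homD[OF h(1)]
    have "p \<cdot> (h \<cdot> t) = (v \<cdot> H) \<cdot> e\<^sub>0" using hs by (simp add: comp_ext[OF h(3)] H(2))
    then obtain G where G: "G \<in> hom M I (Dom M p)" "G \<cdot> e\<^sub>0 = h \<cdot> t" "p \<cdot> G = v \<cdot> H"
      using liftsE[OF wfs_lifts[OF AnCof_wfs k(7) pF] k(1) p Comp_hom[OF assms(6) h(1)]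
          Comp_hom[OF H(1) v]] by metis
    note hs = hs homD[OF G(1)]
    have "(G \<cdot> e\<^sub>1) \<cdot> c = G \<cdot> (e\<^sub>0 \<cdot> c)" using hs by (simp add: k(4))
    also have "\<dots> = h \<cdot> (t \<cdot> c)" using hs by (simp add: comp_ext[OF G(2)])
    also have "\<dots> = u" by (simp add: h(2) flip: j_def)
    finally have "(G \<cdot> e\<^sub>1) \<cdot> c = u" .
    moreover have "p \<cdot> (G \<cdot> e\<^sub>1) = v" using hs by (simp add: comp_ext[OF G(3)] H(3))
    ultimately show "\<exists>h \<in> hom M C (Dom M p). h \<cdot> c = u \<and> p \<cdot> h = v"
      using Comp_hom[OF k(2) G(1)] by blast
  qed
qed

text \<open>Against fibrations between fibrant objects, a lifting problem for \<open>i\<close> extends along \<open>j\<close> to one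
  for \<open>j \<cdot> i\<close>, so that \<open>i\<close> is an acyclic cofibration.\<close>

lemma core_anodyne_cancel_left:
  assumes "i \<in> Cof M" "i \<in> hom M A B" "is_cofibrant A" "j \<in> AnCof M" "j \<in> hom M B D"
    "j \<cdot> i \<in> AnCof M"
  shows "i \<in> AnCof M"
proof -
  have "lifts M i p" if pF: "p \<in> Fib M" and Y: "is_fibrant (Cod M p)" for p
  proof (rule liftsI[OF assms(2)])
    show p: "p \<in> hom M (Dom M p) (Cod M p)"
      using wfs_right_Arr[OF AnCof_wfs pF] by (auto intro: homI)
    fix u v assume u: "u \<in> hom M A (Dom M p)" and v: "v \<in> hom M B (Cod M p)" and pu: "p \<cdot> u = v \<cdot> i"
    obtain w where w: "w \<in> hom M D (Cod M p)" "w \<cdot> j = v"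
      using fibrant_extension[OF Y assms(4,5) v] .
    note hs = homD[OF assms(2)] homD[OF assms(5)] homD[OF w(1)] homD[OF p]
    have "p \<cdot> u = w \<cdot> (j \<cdot> i)" using hs by (simp add: comp_ext[OF w(2)] pu)
    then obtain h where h: "h \<in> hom M D (Dom M p)" "h \<cdot> (j \<cdot> i) = u" "p \<cdot> h = w"
      using liftsE[OF wfs_lifts[OF AnCof_wfs assms(6) pF] Comp_hom[OF assms(2,5)] p u w(1)] by metis
    have "(h \<cdot> j) \<cdot> i = u" "p \<cdot> (h \<cdot> j) = v"
      using hs homD[OF h(1)] by (simp_all add: h(2) comp_ext[OF h(3)] w(2))
    then show "\<exists>h \<in> hom M B (Dom M p). h \<cdot> i = u \<and> p \<cdot> h = v" using Comp_hom[OF assms(5) h(1)] by blast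
  qed
  then have "acyclic_cofibration M i" using assms(1) by (simp add: acyclic_cofibration_def)
  then show ?thesis
    using saturated assms(3) homD(2)[OF assms(2)] unfolding core_left_saturated_def by blast
qed

text \<open>Factor \<open>i\<close> as an anodyne cofibration \<open>j\<close> followed by a fibration \<open>p\<close>. Since \<open>i\<close> is an
  equivalence, \<open>j\<close> extends along \<open>i\<close> up to homotopy, hence, by homotopy extension, to some \<open>w\<close>
  with \<open>w \<cdot> i = j\<close>. Then \<open>p \<cdot> w\<close> is homotopic to the identity, as both restrict to \<open>i\<close>. Factor \<open>w\<close>
  as a cofibration \<open>k\<close> followed by an anodyne fibration \<open>t\<close>. Now \<open>k \<cdot> i\<close> is anodyne because
  \<open>t \<cdot> (k \<cdot> i) = j\<close> is, and by homotopy extension \<open>p \<cdot> t\<close> deforms to a retraction of \<open>k\<close>, which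
  makes \<open>i\<close> a retract of \<open>k \<cdot> i\<close>.\<close>

lemma core_Cof_equivalence_AnCof_fibrant:
  assumes "i \<in> Cof M" "i \<in> hom M A B" "is_cofibrant A" "is_fibrant B" "core_equivalence A B i"
  shows "i \<in> AnCof M"
proof -
  have B: "is_bifibrant B" using cofibrant_Cod_Cof[OF assms(3,1,2)] assms(4) by blast
  have IB: "Ide M B \<in> hom M B B" using homD(5)[OF assms(2)] by (rule Ide_hom)
  obtain E j p where f: "j \<in> AnCof M" "p \<in> Fib M" "j \<in> hom M A E" "p \<in> hom M E B" "i = p \<cdot> j"
    using wfs_factorE[OF AnCof_wfs assms(2)] .
  have E: "is_bifibrant E"
    using cofibrant_Cod_Cof[OF assms(3) AnCof_Cof[OF f(1)] f(3)] fibrant_Dom_Fib[OF assms(4) f(2,4)] by blast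
  obtain w0 where w0: "w0 \<in> hom M B E" "homotopic A E (w0 \<cdot> i) j"
    using core_equivalence_surj[OF assms(5) E f(3)] .
  obtain w where w: "w \<in> hom M B E" "w \<cdot> i = j"
    using homotopy_extension[OF assms(1-3) w0] .
  have pw: "p \<cdot> w \<in> hom M B B" using Comp_hom[OF w(1) f(4)] .
  have "(p \<cdot> w) \<cdot> i = Ide M B \<cdot> i"
    using homD[OF assms(2)] homD[OF w(1)] homD[OF f(4)] w(2) f(5)[symmetric] by simp
  then have pw1: "homotopic B B (p \<cdot> w) (Ide M B)"
    using core_equivalence_inj[OF assms(5) B pw IB] homotopic_refl[OF B Comp_hom[OF assms(2) pw]] by simp
  obtain D k t where g: "k \<in> Cof M" "t \<in> AnFib M" "k \<in> hom M B D" "t \<in> hom M D E" "w = t \<cdot> k"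
    using wfs_factorE[OF Cof_wfs w(1)] .
  have D: "is_fibrant D" using fibrant_Dom_Fib[OF _ AnFib_Fib[OF g(2)] g(4)] E by blast
  note hs = homD[OF assms(2)] homD[OF f(4)] homD[OF g(3)] homD[OF g(4)]
  have ki: "k \<cdot> i \<in> Cof M" "k \<cdot> i \<in> hom M A D"
    using wfs_left_comp[OF Cof_wfs assms(1) g(1) assms(2) g(3)] Comp_hom[OF assms(2) g(3)] .
  have "(t \<cdot> k) \<cdot> i = j" using w(2) g(5) by simp
  then have "t \<cdot> (k \<cdot> i) \<in> AnCof M" using hs f(1) by simp
  then have an: "k \<cdot> i \<in> AnCof M"
    using anodyne_of_anodyne_fibration_comp[OF ki assms(3) D g(2,4)] by blast
  have "p \<cdot> (t \<cdot> k) = (p \<cdot> t) \<cdot> k" using hs by simp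
  then have "homotopic B B ((p \<cdot> t) \<cdot> k) (Ide M B)" using pw1 g(5) by simp
  then obtain m where m: "m \<in> hom M D B" "m \<cdot> k = Ide M B"
    using homotopy_extension[OF g(1,3) _ Comp_hom[OF g(4) f(4)]] B by blast
  have "retract_of M i (k \<cdot> i)" using retract_ofI_left[OF assms(2) ki(2) g(3) m(1) refl m(2)] .
  then show ?thesis using wfs_left_retract[OF AnCof_wfs _ an] by blast
qed

lemma core_Cof_equivalence_AnCof:
  assumes "i \<in> Cof M" "i \<in> hom M A B" "is_cofibrant A" "core_equivalence A B i"
  shows "i \<in> AnCof M"
proof -
  obtain B' j where j: "is_fibrant B'" "j \<in> AnCof M" "j \<in> hom M B B'"
    using fibrant_replacement[OF homD(5)[OF assms(2)]] .
  have ji: "j \<cdot> i \<in> Cof M" "j \<cdot> i \<in> hom M A B'"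
    using wfs_left_comp[OF Cof_wfs assms(1) AnCof_Cof[OF j(2)] assms(2) j(3)] Comp_hom[OF assms(2) j(3)] .
  have "core_equivalence A B' (j \<cdot> i)"
    using core_equivalence_comp[OF assms(3,4) core_AnCof_core_equivalence[OF j(2,3)]] .
  then have "j \<cdot> i \<in> AnCof M" using core_Cof_equivalence_AnCof_fibrant[OF ji assms(3) j(1)] by blast
  then show ?thesis using core_anodyne_cancel_left[OF assms(1-3) j(2,3)] by blast
qed

end

section \<open>The semi-model structure\<close>

context cylindrical_structure
begin

definition cofibrant_model :: "'a \<Rightarrow> 'o \<Rightarrow> 'o \<Rightarrow> 'a \<Rightarrow> 'a \<Rightarrow> 'a \<Rightarrow> bool" where
  "cofibrant_model f X' Y' a b f' \<longleftrightarrow> is_cofibrant X' \<and> is_cofibrant Y' \<and>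
     a \<in> AnFib M \<and> a \<in> hom M X' (Dom M f) \<and> b \<in> AnFib M \<and> b \<in> hom M Y' (Cod M f) \<and>
     f' \<in> hom M X' Y' \<and> b \<cdot> f' = f \<cdot> a"

definition weak_equivalences :: "'a set" where
  "weak_equivalences = {f \<in> Arr M. \<exists>X' Y' a b f'. cofibrant_model f X' Y' a b f' \<and>
     core_equivalence X' Y' f'}"

lemma cofibrant_model_exists:
  assumes "f \<in> hom M X Y" "is_cofibrant X'" "a \<in> AnFib M" "a \<in> hom M X' X"
    "is_cofibrant Y'" "b \<in> AnFib M" "b \<in> hom M Y' Y"
  obtains f' where "cofibrant_model f X' Y' a b f'"
proof -
  obtain f' where "f' \<in> hom M X' Y'" "b \<cdot> f' = f \<cdot> a"
    using cofibrant_lift[OF assms(2,6,7) Comp_hom[OF assms(4,1)]] .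
  then show ?thesis
    using that assms homD(2,3)[OF assms(1)] unfolding cofibrant_model_def by blast
qed

lemma comparison_core_equivalence:
  assumes "is_cofibrant A" "is_cofibrant B" "a \<in> AnFib M" "a \<in> hom M A X" "b \<in> AnFib M"
    "b \<in> hom M B X" "x \<in> hom M A B" "b \<cdot> x = a"
  shows "core_equivalence A B x"
proof -
  obtain y where y: "y \<in> hom M B A" "a \<cdot> y = b" using cofibrant_lift[OF assms(2-4,6)] .
  note hs = homD[OF assms(4)] homD[OF assms(6)] homD[OF assms(7)] homD[OF y(1)]
  have I: "Ide M A \<in> hom M A A" "Ide M B \<in> hom M B B" using hs by (auto intro: Ide_hom)
  have "a \<cdot> (y \<cdot> x) = a \<cdot> Ide M A" "b \<cdot> (x \<cdot> y) = b \<cdot> Ide M B"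
    using hs by (simp_all add: comp_ext[OF y(2)] comp_ext[OF assms(8)] y(2) assms(8))
  then show ?thesis
    using homotopy_equivalence_core_equivalence[OF assms(1,2,7) y(1)]
      lifts_identified[OF assms(1,3,4) Comp_hom[OF assms(7) y(1)] I(1)]
      lifts_identified[OF assms(2,5,6) Comp_hom[OF y(1) assms(7)] I(2)] by blast
qed

text \<open>Lifting the identities compares two models of \<open>f\<close> by equivalences \<open>x\<close> and \<open>y\<close>. The square
  that they form commutes up to identification, both of its composites being lifts of the same
  map.\<close>

lemma cofibrant_model_independent:
  assumes "f \<in> Arr M" "cofibrant_model f X1 Y1 a1 b1 f1" "cofibrant_model f X2 Y2 a2 b2 f2"
    "core_equivalence X1 Y1 f1"
  shows "core_equivalence X2 Y2 f2"
proof -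
  have f: "f \<in> hom M (Dom M f) (Cod M f)" using assms(1) by (auto intro: homI)
  have 1: "is_cofibrant X1" "is_cofibrant Y1" "a1 \<in> AnFib M" "a1 \<in> hom M X1 (Dom M f)"
    "b1 \<in> AnFib M" "b1 \<in> hom M Y1 (Cod M f)" "f1 \<in> hom M X1 Y1" "b1 \<cdot> f1 = f \<cdot> a1"
    using assms(2) unfolding cofibrant_model_def by blast+
  have 2: "is_cofibrant X2" "is_cofibrant Y2" "a2 \<in> AnFib M" "a2 \<in> hom M X2 (Dom M f)"
    "b2 \<in> AnFib M" "b2 \<in> hom M Y2 (Cod M f)" "f2 \<in> hom M X2 Y2" "b2 \<cdot> f2 = f \<cdot> a2"
    using assms(3) unfolding cofibrant_model_def by blast+
  obtain x where x: "x \<in> hom M X1 X2" "a2 \<cdot> x = a1" using cofibrant_lift[OF 1(1) 2(3,4) 1(4)] .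
  obtain y where y: "y \<in> hom M Y1 Y2" "b2 \<cdot> y = b1" using cofibrant_lift[OF 1(2) 2(5,6) 1(6)] .
  have xe: "core_equivalence X1 X2 x" using comparison_core_equivalence[OF 1(1) 2(1) 1(3,4) 2(3,4) x] .
  have ye: "core_equivalence Y1 Y2 y" using comparison_core_equivalence[OF 1(2) 2(2) 1(5,6) 2(5,6) y] .
  note hs = homD[OF f] homD[OF 1(4)] homD[OF 1(7)] homD[OF 2(4)] homD[OF 2(6)] homD[OF 2(7)]
    homD[OF x(1)] homD[OF y(1)]
  have "b2 \<cdot> (f2 \<cdot> x) = b2 \<cdot> (y \<cdot> f1)"
    using hs by (simp add: comp_ext[OF 2(8)] comp_ext[OF y(2)] x(2) 1(8))
  then have "identified X1 Y2 (f2 \<cdot> x) (y \<cdot> f1)"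
    using lifts_identified[OF 1(1) 2(5,6) Comp_hom[OF x(1) 2(7)] Comp_hom[OF 1(7) y(1)]] by blast
  then have "core_equivalence X1 Y2 (f2 \<cdot> x)"
    using core_equivalence_identified[OF 1(1) 2(2) core_equivalence_comp[OF 1(1) assms(4) ye]] by blast
  then show ?thesis using core_equivalence_cancel_right[OF 1(1) xe _ 2(7)] by blast
qed

lemma weak_equivalences_iff_model:
  assumes "f \<in> Arr M" "cofibrant_model f X' Y' a b f'"
  shows "f \<in> weak_equivalences \<longleftrightarrow> core_equivalence X' Y' f'"
  using assms cofibrant_model_independent[OF assms(1)] unfolding weak_equivalences_def by blast

lemma weak_equivalences_iff_core:
  assumes "f \<in> hom M A B" "is_cofibrant A" "is_cofibrant B"
  shows "f \<in> weak_equivalences \<longleftrightarrow> core_equivalence A B f"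
proof -
  have "cofibrant_model f A B (Ide M A) (Ide M B) f"
    using assms homD[OF assms(1)] wfs_right_Ide[OF Cof_wfs] Ide_hom
    unfolding cofibrant_model_def by simp
  then show ?thesis using weak_equivalences_iff_model homD(1)[OF assms(1)] by blast
qed

lemma weak_equivalences_two_out_of_three: "two_out_of_three M weak_equivalences"
  unfolding two_out_of_three_def
proof (intro ballI impI)
  fix f g assume fg: "f \<in> Arr M" "g \<in> Arr M" "Cod M f = Dom M g"
  define X Y Z where "X = Dom M f" and "Y = Dom M g" and "Z = Cod M g"
  have f: "f \<in> hom M X Y" and g: "g \<in> hom M Y Z" using fg by (auto simp: X_def Y_def Z_def intro: homI)
  obtain X' a where a: "is_cofibrant X'" "a \<in> AnFib M" "a \<in> hom M X' X"
    using cofibrant_replacement[OF homD(4)[OF f]] .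
  obtain Y' b where b: "is_cofibrant Y'" "b \<in> AnFib M" "b \<in> hom M Y' Y"
    using cofibrant_replacement[OF homD(4)[OF g]] .
  obtain Z' c where c: "is_cofibrant Z'" "c \<in> AnFib M" "c \<in> hom M Z' Z"
    using cofibrant_replacement[OF homD(5)[OF g]] .
  obtain f' where f': "cofibrant_model f X' Y' a b f'" using cofibrant_model_exists[OF f a b] .
  obtain g' where g': "cofibrant_model g Y' Z' b c g'" using cofibrant_model_exists[OF g b c] .
  have h: "f' \<in> hom M X' Y'" "g' \<in> hom M Y' Z'" and e: "b \<cdot> f' = f \<cdot> a" "c \<cdot> g' = g \<cdot> b"
    using f' g' unfolding cofibrant_model_def by blast+
  note hs = homD[OF f] homD[OF g] homD[OF a(3)] homD[OF b(3)] homD[OF c(3)] homD[OF h(1)] homD[OF h(2)]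
  have "c \<cdot> (g' \<cdot> f') = (g \<cdot> f) \<cdot> a" using hs by (simp add: comp_ext[OF e(2)] e(1))
  then have gf': "cofibrant_model (g \<cdot> f) X' Z' a c (g' \<cdot> f')"
    using a b c Comp_hom[OF h] hs unfolding cofibrant_model_def by simp
  have gf: "g \<cdot> f \<in> Arr M" using hs by simp
  note iff = weak_equivalences_iff_model[OF fg(1) f'] weak_equivalences_iff_model[OF fg(2) g']
    weak_equivalences_iff_model[OF gf gf']
  show "(f \<in> weak_equivalences \<and> g \<in> weak_equivalences \<longrightarrow> g \<cdot> f \<in> weak_equivalences) \<and>
        (f \<in> weak_equivalences \<and> g \<cdot> f \<in> weak_equivalences \<longrightarrow> g \<in> weak_equivalences) \<and>
        (g \<in> weak_equivalences \<and> g \<cdot> f \<in> weak_equivalences \<longrightarrow> f \<in> weak_equivalences)"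
    unfolding iff
    using core_equivalence_comp[OF a(1)] core_equivalence_cancel_right[OF a(1) _ _ h(2)]
      core_equivalence_cancel_left[OF a(1) b(1) _ _ h(1)] by blast
qed

text \<open>All maps of a retract diagram lift to cofibrant replacements. The diagram of the lifts commutes
  only up to identification.\<close>

lemma weak_equivalences_retract_stable: "retract_stable M weak_equivalences"
  unfolding retract_stable_def
proof (intro ballI allI impI)
  fix g f assume gW: "g \<in> weak_equivalences" and ret: "retract_of M f g"
  define X Y X2 Y2 where "X = Dom M f" and "Y = Cod M f" and "X2 = Dom M g" and "Y2 = Cod M g"
  obtain s r s' r' where fA: "f \<in> Arr M" and gA: "g \<in> Arr M" and
    s: "s \<in> hom M X X2" and r: "r \<in> hom M X2 X" and s': "s' \<in> hom M Y Y2" and r': "r' \<in> hom M Y2 Y" and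
    eq: "r \<cdot> s = Ide M X" "r' \<cdot> s' = Ide M Y" "g \<cdot> s = s' \<cdot> f" "f \<cdot> r = r' \<cdot> g"
    using ret unfolding retract_of_def X_def Y_def X2_def Y2_def by blast
  have f: "f \<in> hom M X Y" and g: "g \<in> hom M X2 Y2"
    using fA gA by (auto simp: X_def Y_def X2_def Y2_def intro: homI)
  obtain A a where A: "is_cofibrant A" "a \<in> AnFib M" "a \<in> hom M A X"
    using cofibrant_replacement[OF homD(4)[OF f]] .
  obtain B b where B: "is_cofibrant B" "b \<in> AnFib M" "b \<in> hom M B Y"
    using cofibrant_replacement[OF homD(5)[OF f]] .
  obtain A2 a2 where A2: "is_cofibrant A2" "a2 \<in> AnFib M" "a2 \<in> hom M A2 X2"
    using cofibrant_replacement[OF homD(4)[OF g]] .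
  obtain B2 b2 where B2: "is_cofibrant B2" "b2 \<in> AnFib M" "b2 \<in> hom M B2 Y2"
    using cofibrant_replacement[OF homD(5)[OF g]] .
  obtain fl where fm: "cofibrant_model f A B a b fl" using cofibrant_model_exists[OF f A B] .
  obtain gl where gm: "cofibrant_model g A2 B2 a2 b2 gl" using cofibrant_model_exists[OF g A2 B2] .
  have fl: "fl \<in> hom M A B" "b \<cdot> fl = f \<cdot> a" and gl: "gl \<in> hom M A2 B2" "b2 \<cdot> gl = g \<cdot> a2"
    using fm gm unfolding cofibrant_model_def by blast+
  obtain sl where sl: "sl \<in> hom M A A2" "a2 \<cdot> sl = s \<cdot> a"
    using cofibrant_lift[OF A(1) A2(2,3) Comp_hom[OF A(3) s]] .
  obtain rl where rl: "rl \<in> hom M A2 A" "a \<cdot> rl = r \<cdot> a2"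
    using cofibrant_lift[OF A2(1) A(2,3) Comp_hom[OF A2(3) r]] .
  obtain sl' where sl': "sl' \<in> hom M B B2" "b2 \<cdot> sl' = s' \<cdot> b"
    using cofibrant_lift[OF B(1) B2(2,3) Comp_hom[OF B(3) s']] .
  obtain rl' where rl': "rl' \<in> hom M B2 B" "b \<cdot> rl' = r' \<cdot> b2"
    using cofibrant_lift[OF B2(1) B(2,3) Comp_hom[OF B2(3) r']] .
  note hs = homD[OF f] homD[OF g] homD[OF s] homD[OF r] homD[OF s'] homD[OF r'] homD[OF A(3)]
    homD[OF B(3)] homD[OF A2(3)] homD[OF B2(3)] homD[OF fl(1)] homD[OF gl(1)] homD[OF sl(1)]
    homD[OF rl(1)] homD[OF sl'(1)] homD[OF rl'(1)]
  have I: "Ide M A \<in> hom M A A" "Ide M B \<in> hom M B B" using hs by (auto intro: Ide_hom)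
  have "a \<cdot> (rl \<cdot> sl) = a \<cdot> Ide M A" "b \<cdot> (rl' \<cdot> sl') = b \<cdot> Ide M B"
    "b2 \<cdot> (gl \<cdot> sl) = b2 \<cdot> (sl' \<cdot> fl)" "b \<cdot> (fl \<cdot> rl) = b \<cdot> (rl' \<cdot> gl)"
    using hs by (simp_all add: comp_ext[OF rl(2)] comp_ext[OF rl'(2)] comp_ext[OF gl(2)]
        comp_ext[OF sl'(2)] comp_ext[OF fl(2)] sl(2) sl'(2) fl(2) gl(2) rl(2)
        comp_ext[OF eq(1)] comp_ext[OF eq(2)] comp_ext[OF eq(3)] comp_ext[OF eq(4)])
  then have "identified A A (rl \<cdot> sl) (Ide M A)" "identified B B (rl' \<cdot> sl') (Ide M B)"
    "identified A B2 (gl \<cdot> sl) (sl' \<cdot> fl)" "identified A2 B (fl \<cdot> rl) (rl' \<cdot> gl)"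
    using lifts_identified[OF A(1) A(2,3) Comp_hom[OF sl(1) rl(1)] I(1)]
      lifts_identified[OF B(1) B(2,3) Comp_hom[OF sl'(1) rl'(1)] I(2)]
      lifts_identified[OF A(1) B2(2,3) Comp_hom[OF sl(1) gl(1)] Comp_hom[OF fl(1) sl'(1)]]
      lifts_identified[OF A2(1) B(2,3) Comp_hom[OF rl(1) fl(1)] Comp_hom[OF gl(1) rl'(1)]]
    by blast+
  moreover have "core_equivalence A2 B2 gl" using gW weak_equivalences_iff_model[OF gA gm] by blast
  ultimately have "core_equivalence A B fl"
    using core_equivalence_retract[OF A(1) B(1) _ fl(1) sl(1) rl(1) sl'(1) rl'(1) A2(1)] by blast
  then show "f \<in> weak_equivalences" using weak_equivalences_iff_model[OF fA fm] by blast
qed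

lemma AnFib_weak_equivalences:
  assumes "q \<in> AnFib M"
  shows "q \<in> weak_equivalences"
proof -
  have q: "q \<in> hom M (Dom M q) (Cod M q)" using wfs_right_Arr[OF Cof_wfs assms] by (auto intro: homI)
  obtain X' a where a: "is_cofibrant X'" "a \<in> AnFib M" "a \<in> hom M X' (Dom M q)"
    using cofibrant_replacement[OF homD(4)[OF q]] .
  have qa: "q \<cdot> a \<in> AnFib M" "q \<cdot> a \<in> hom M X' (Cod M q)"
    using wfs_right_comp[OF Cof_wfs a(2) assms a(3) q] Comp_hom[OF a(3) q] .
  have "cofibrant_model q X' X' a (q \<cdot> a) (Ide M X')"
    using a qa Ide_hom[OF cofibrant_Obj[OF a(1)]] homD[OF qa(2)] unfolding cofibrant_model_def by simp
  then show ?thesis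
    using weak_equivalences_iff_model core_equivalence_Ide[OF a(1)] homD(1)[OF q] by blast
qed

lemma core_Cof_weak_equivalences_iff:
  assumes "i \<in> Cof M" "i \<in> hom M A B" "is_cofibrant A"
  shows "i \<in> weak_equivalences \<longleftrightarrow> i \<in> AnCof M"
  using weak_equivalences_iff_core[OF assms(2,3) cofibrant_Cod_Cof[OF assms(3,1,2)]]
    core_Cof_equivalence_AnCof[OF assms] core_AnCof_core_equivalence[OF _ assms(2)] by blast

text \<open>Replace the domain by a cofibrant one, \<open>a\<close>, and factor \<open>p \<cdot> a\<close> as a cofibration \<open>c\<close> followed by
  an anodyne fibration. Then \<open>c\<close> is an equivalence, so anodyne, and the retract argument makes
  \<open>p \<cdot> a\<close> itself an anodyne fibration. Maps from cofibrant objects lift along \<open>a\<close>.\<close>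

lemma Fib_weak_equivalences_lifts:
  assumes "p \<in> Fib M" "p \<in> weak_equivalences" "i \<in> Cof M" "is_cofibrant (Dom M i)"
  shows "lifts M i p"
proof -
  have p: "p \<in> hom M (Dom M p) (Cod M p)" using wfs_right_Arr[OF AnCof_wfs assms(1)] by (auto intro: homI)
  have i: "i \<in> hom M (Dom M i) (Cod M i)" using wfs_left_Arr[OF Cof_wfs assms(3)] by (auto intro: homI)
  obtain X' a where a: "is_cofibrant X'" "a \<in> AnFib M" "a \<in> hom M X' (Dom M p)"
    using cofibrant_replacement[OF homD(4)[OF p]] .
  have pa: "p \<cdot> a \<in> Fib M" "p \<cdot> a \<in> hom M X' (Cod M p)"
    using wfs_right_comp[OF AnCof_wfs AnFib_Fib[OF a(2)] assms(1) a(3) p] Comp_hom[OF a(3) p] .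
  obtain Y' c b where b: "c \<in> Cof M" "b \<in> AnFib M" "c \<in> hom M X' Y'" "b \<in> hom M Y' (Cod M p)"
    "p \<cdot> a = b \<cdot> c"
    using wfs_factorE[OF Cof_wfs pa(2)] .
  have "cofibrant_model p X' Y' a b c"
    using a b cofibrant_Cod_Cof[OF a(1) b(1,3)] unfolding cofibrant_model_def by simp
  then have "core_equivalence X' Y' c" using weak_equivalences_iff_model homD(1)[OF p] assms(2) by blast
  then have "c \<in> AnCof M" using core_Cof_equivalence_AnCof[OF b(1,3) a(1)] by blast
  then have "retract_of M (p \<cdot> a) b"
    using retract_argument_right[OF b(3-5)] wfs_lifts[OF AnCof_wfs _ pa(1)] by blast
  then have an: "p \<cdot> a \<in> AnFib M" using wfs_right_retract[OF Cof_wfs _ b(2)] by blast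
  show ?thesis
  proof (rule liftsI[OF i p])
    fix u v assume u: "u \<in> hom M (Dom M i) (Dom M p)" and v: "v \<in> hom M (Cod M i) (Cod M p)"
      and e: "p \<cdot> u = v \<cdot> i"
    obtain u' where u': "u' \<in> hom M (Dom M i) X'" "a \<cdot> u' = u" using cofibrant_lift[OF assms(4) a(2,3) u] .
    note hs = homD[OF p] homD[OF i] homD[OF a(3)] homD[OF u'(1)]
    have "(p \<cdot> a) \<cdot> u' = v \<cdot> i" using hs by (simp add: u'(2) e)
    then obtain h where h: "h \<in> hom M (Cod M i) X'" "h \<cdot> i = u'" "(p \<cdot> a) \<cdot> h = v"
      using liftsE[OF wfs_lifts[OF Cof_wfs assms(3) an] i pa(2) u'(1) v] by metis
    have "(a \<cdot> h) \<cdot> i = u" "p \<cdot> (a \<cdot> h) = v"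
      using hs homD[OF h(1)] h(3) by (simp_all add: h(2) u'(2))
    then show "\<exists>h\<in>hom M (Cod M i) (Dom M p). h \<cdot> i = u \<and> p \<cdot> h = v" using Comp_hom[OF h(1) a(3)] by blast
  qed
qed

lemma weak_equivalences_fresse: "fresse_left_semi_model K M weak_equivalences (Cof M) (Fib M)"
  unfolding fresse_left_semi_model_def
proof (intro conjI ballI allI impI)
  show "category M" "complete K M" "cocomplete K M"
    by (rule category_axioms complete cocomplete)+
  show "weak_equivalences \<subseteq> Arr M" "Cof M \<subseteq> Arr M" "Fib M \<subseteq> Arr M"
    using wfs_left_Arr[OF Cof_wfs] wfs_right_Arr[OF AnCof_wfs] by (auto simp: weak_equivalences_def)
  show "two_out_of_three M weak_equivalences" "retract_stable M weak_equivalences"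
    by (rule weak_equivalences_two_out_of_three weak_equivalences_retract_stable)+
  show "retract_stable M (Cof M)" "retract_stable M (Fib M)"
    using wfs_left_retract[OF Cof_wfs] wfs_right_retract[OF AnCof_wfs] by (auto simp: retract_stable_def)
  show "pullback_stable M (Fib M)"
    using wfs_right_pullback[OF AnCof_wfs] unfolding pullback_stable_def by blast
  show "is_cofibrant Z" if "is_initial M Z" for Z using initial_cofibrant[OF that] .
next
  fix f assume "f \<in> Arr M" and X: "is_cofibrant (Dom M f)"
  then have f: "f \<in> hom M (Dom M f) (Cod M f)" by (auto intro: homI)
  obtain E l r where 1: "l \<in> Cof M" "r \<in> AnFib M" "l \<in> hom M (Dom M f) E" "r \<in> hom M E (Cod M f)"
    "f = r \<cdot> l"
    using wfs_factorE[OF Cof_wfs f] .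
  have "r \<in> Fib M \<inter> weak_equivalences" using AnFib_Fib AnFib_weak_equivalences 1(2) by blast
  then show "factors_as M (Cof M) (Fib M \<inter> weak_equivalences) f"
    unfolding factors_as_def using 1(1,5) homD[OF 1(3)] homD[OF 1(4)] by metis
  obtain E' l' r' where 2: "l' \<in> AnCof M" "r' \<in> Fib M" "l' \<in> hom M (Dom M f) E'"
    "r' \<in> hom M E' (Cod M f)" "f = r' \<cdot> l'"
    using wfs_factorE[OF AnCof_wfs f] .
  have "l' \<in> Cof M \<inter> weak_equivalences"
    using AnCof_Cof[OF 2(1)] core_Cof_weak_equivalences_iff[OF _ 2(3) X] 2(1) by blast
  then show "factors_as M (Cof M \<inter> weak_equivalences) (Fib M) f"
    unfolding factors_as_def using 2(2,5) homD[OF 2(3)] homD[OF 2(4)] by metis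
next
  fix i p assume i: "i \<in> Cof M" and p: "p \<in> Fib M"
    and *: "is_cofibrant (Dom M i) \<and> (i \<in> weak_equivalences \<or> p \<in> weak_equivalences)"
  have ih: "i \<in> hom M (Dom M i) (Cod M i)" using wfs_left_Arr[OF Cof_wfs i] by (auto intro: homI)
  show "lifts M i p"
    using * core_Cof_weak_equivalences_iff[OF i ih] wfs_lifts[OF AnCof_wfs _ p]
      Fib_weak_equivalences_lifts[OF p _ i] by blast
qed

end

theorem theorem3p7:
  fixes M :: "('o, 'a) premodel"
  assumes "infinite (UNIV :: 'k set)"
    and "premodel_category TYPE('k) M"
  shows
    "((\<exists>W. fresse_left_semi_model TYPE('k) M W (Cof M) (Fib M)) \<longleftrightarrow>
        weak_model_category TYPE('k) M \<and>
        (\<forall>X \<in> Obj M. cofibrant M (Cof M) X \<longrightarrow> has_strong_cylinder M X) \<and>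
        core_left_saturated M) \<and>
     (weak_model_category TYPE('k) M \<and>
        (\<forall>X \<in> Obj M. cofibrant M (Cof M) X \<longrightarrow> has_strong_cylinder M X) \<and>
        core_left_saturated M \<longrightarrow>
        (\<exists>!W. fresse_left_semi_model TYPE('k) M W (Cof M) (Fib M)) \<and>
        (\<forall>W. fresse_left_semi_model TYPE('k) M W (Cof M) (Fib M) \<longrightarrow>
           (spitzweck_left_semi_model TYPE('k) M W (Cof M) (Fib M) \<longleftrightarrow> right_saturated M)))"
proof -
  have "category M" using assms(2) by (simp add: premodel_category_def)
  then interpret premodel_structure M "TYPE('k)"
    using assms by (simp add: premodel_structure_def premodel_structure_axioms_def)
  let ?conditions = "weak_model_category TYPE('k) M \<and>
    (\<forall>X \<in> Obj M. is_cofibrant X \<longrightarrow> has_strong_cylinder M X) \<and> core_left_saturated M"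
  let ?fresse = "\<lambda>W. fresse_left_semi_model TYPE('k) M W (Cof M) (Fib M)"
  have fresse: "fresse_structure M TYPE('k) W" if "?fresse W" for W
    using that by unfold_locales
  have necessary: "?conditions" if "?fresse W" for W
    using fresse_structure.weak_model_category[OF fresse[OF that]]
      fresse_structure.cofibrant_has_strong_cylinder[OF fresse[OF that]]
      fresse_structure.core_left_saturated[OF fresse[OF that]] by blast
  have sufficient: "\<exists>W. ?fresse W" if "?conditions"
  proof -
    have "cylindrical_structure M TYPE('k)"
      using that cofibrant_Obj by unfold_locales blast+
    then show ?thesis using cylindrical_structure.weak_equivalences_fresse by blast
  qed
  have unique: "W = W'" if "?fresse W" "?fresse W'" for W W'
    using fresse_structure.W_iff[OF fresse[OF that(1)]]
      fresse_structure.W_iff[OF fresse[OF that(2)]] by blast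
  have "spitzweck_left_semi_model TYPE('k) M W (Cof M) (Fib M) \<longleftrightarrow> right_saturated M" if "?fresse W" for W
    using fresse_structure.spitzweck_iff_right_saturated[OF fresse[OF that]] .
  with necessary sufficient unique show ?thesis by blast
qed

end
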